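(* Let $n$ be a power of two, let $d\in\{1,2\}$, and let $M^{dn}$ be the small cover ($d=1$) or quasitoric manifold ($d=2$) over a properly $n$-colored simple polytope $P^n$ constructed from the characteristic pair $(P^n,\Lambda)$ described in the context. Then the dual Stiefel-Whitney class $\overline{w}_{d(n-1)}(M^{dn})\in H^{d(n-1)}(M^{dn};\mathbb{Z}_2)$ is nontrivial.
   Context: The total dual Stiefel-Whitney class $\overline{w}(M)=\sum_i\overline{w}_i(M)$ of a smooth manifold $M$ is defined by $w(M)\cdot\overline{w}(M)=1$ in $H^*(M;\mathbb{Z}_2)$, where $w(M)$ is the total Stiefel-Whitney class of the tangent bundle. Construction of $M^{dn}$, $d=1,2$. Let $R_1=\mathbb{Z}_2$, $R_2=\mathbb{Z}$, $G_1=S^0=\{\pm1\}$, $G_2=S^1\subset\mathbb{C}$. Let $P^n$ be a simple $n$-polytope (exactly $n$ facets meet at each vertex) with a proper coloring $h$ of its facets $F_1,\dots,F_m$ in $n$ colors, i.e. $h:\{F_1,\dots,F_m\}\to\{1,\dots,n\}$ and $h(F)\ne h(F')$ for distinct intersecting facets. Put $\mathcal{F}_i=h^{-1}(i)$. Fix a vertex $V=H_1\cap\cdots\cap H_n$ with $h(H_i)=i$. Assign to $H_i$ the vector $\lambda_{H_i}=(0,\dots,0,1,\dots,1)^t\in R_d^n$ with $i-1$ zeros followed by $n-i+1$ ones, and to every $F\in\mathcal{F}_i\setminus\{H_i\}$ the $i$-th standard basis vector $\lambda_F=e_i\in R_d^n$. Let $\Lambda$ be the matrix whose columns are these vectors.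 For $\lambda=(\lambda_1,\dots,\lambda_n)$ let $G_\lambda=\{(1,\dots,1),((-1)^{\lambda_1},\dots,(-1)^{\lambda_n})\}$ if $d=1$ and $G_\lambda=\{(e^{2\pi i\lambda_1 t},\dots,e^{2\pi i\lambda_n t}): t\in\mathbb{R}\}$ if $d=2$. For $q\in P^n$ let $G(q)\subset G_d^n$ be the subgroup generated by the $G_{\lambda_F}$ for the facets $F$ containing $q$. Then $M^{dn}=M(P^n,\Lambda)=G_d^n\times P^n/\sim$, where $(t_1,p)\sim(t_2,q)$ iff $p=q$ and $t_1t_2^{-1}\in G(q)$. It is a smooth closed $dn$-manifold with locally standard $G_d^n$-action (locally modelled, up to an automorphism of $G_d^n$, on the coordinatewise action on $\mathbb{R}^n$ for $d=1$, $\mathbb{C}^n$ for $d=2$) and orbit space $P^n$, determined by $(P^n,\Lambda)$ up to weakly equivariant diffeomorphism; it is a small cover over $P^n$ if $d=1$ and a quasitoric manifold over $P^n$ if $d=2$. Known description (Davis-Januszkiewicz): for a facet $F$ let $v_F\in H^d(M^{dn};\mathbb{Z}_2)$ be the (mod 2) Poincar\'e dual of the characteristic submanifold $\pi^{-1}(F)$, where $\pi:M^{dn}\to P^n$ is the projection, and write $u_i=v_{H_i}$. Then $H^*(M^{dn};\mathbb{Z}_2)$ is the quotient of the polynomial ring over $\mathbb{Z}_2$ in these classes by the ideal generated by the monomials $v_{F_{i_1}}\cdots v_{F_{i_k}}$ with $F_{i_1}\cap\cdots\cap F_{i_k}=\emptyset$ ($i_1<\dots<i_k$) and by the linear forms $\sum_{j=1}^{i}u_j+\sum_{F\in\mathcal{F}_i\setminus\{H_i\}}v_F$,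 $i=1,\dots,n$; and $w(M^{dn})=\prod_{F}(1+v_F)$, the product over all facets. *)

theory Defs
  imports
    "HOL-Analysis.Analysis"
    "HOL-Homology.Homology"
    "HOL-Algebra.QuotRing"
    "HOL-Algebra.Product_Groups"
    "HOL-Algebra.Generated_Groups"
    "HOL-Library.Poly_Mapping"
    "HOL-Library.Z2"
begin

section \<open>Quotient topology\<close>

definition quotient_topology :: "'a topology \<Rightarrow> ('a \<Rightarrow> 'b) \<Rightarrow> 'b topology" where
  "quotient_topology X q =
     topology (\<lambda>U. U \<subseteq> q ` topspace X \<and> openin X {x \<in> topspace X. q x \<in> U})"

lemma openin_quotient_topology:
  "openin (quotient_topology X q) U \<longleftrightarrow>
     U \<subseteq> q ` topspace X \<and> openin X {x \<in> topspace X. q x \<in> U}"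
proof -
  have "istopology (\<lambda>U. U \<subseteq> q ` topspace X \<and> openin X {x \<in> topspace X. q x \<in> U})"
    unfolding istopology_def
  proof (intro conjI allI impI)
    fix S T
    assume S: "S \<subseteq> q ` topspace X \<and> openin X {x \<in> topspace X. q x \<in> S}"
      and T: "T \<subseteq> q ` topspace X \<and> openin X {x \<in> topspace X. q x \<in> T}"
    have "{x \<in> topspace X. q x \<in> S \<inter> T}
        = {x \<in> topspace X. q x \<in> S} \<inter> {x \<in> topspace X. q x \<in> T}"
      by auto
    then show "openin X {x \<in> topspace X. q x \<in> S \<inter> T}"
      using S T by auto
    show "S \<inter> T \<subseteq> q ` topspace X"
      using S by auto
  next
    fix \<K>
    assume K: "\<forall>K\<in>\<K>. K \<subseteq> q ` topspace X \<and> openin X {x \<in> topspace X. q x \<in> K}"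
    have "{x \<in> topspace X. q x \<in> \<Union>\<K>} = (\<Union>K\<in>\<K>. {x \<in> topspace X. q x \<in> K})"
      by auto
    then show "openin X {x \<in> topspace X. q x \<in> \<Union>\<K>}"
      using K by auto
    show "\<Union>\<K> \<subseteq> q ` topspace X"
      using K by auto
  qed
  then show ?thesis
    by (simp add: quotient_topology_def)
qed

lemma quotient_map_quotient_topology: "quotient_map X (quotient_topology X q) q"
proof -
  have "{x \<in> topspace X. q x \<in> q ` topspace X} = topspace X"
    by auto
  then have "openin (quotient_topology X q) (q ` topspace X)"
    by (simp add: openin_quotient_topology)
  then have "topspace (quotient_topology X q) = q ` topspace X"
    by (metis openin_quotient_topology openin_subset openin_topspace subset_antisym)
  then show ?thesis
    unfolding quotient_map_def by (auto simp: openin_quotient_topology)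
qed


section \<open>The singular cohomology ring with coefficients in the field of two elements\<close>

text \<open>A cochain is a family indexed by the degree, with finitely many nonzero members; so the
  cohomology ring below is the direct sum of the cohomology groups.  Cochains vanish on arguments
  that are not singular simplices of the space.\<close>

type_synonym 'b cochain = "nat \<Rightarrow> ((nat \<Rightarrow> real) \<Rightarrow> 'b) \<Rightarrow> bit"

definition cochains :: "'b topology \<Rightarrow> 'b cochain set" where
  "cochains X = {a. (\<forall>p f. a p f \<noteq> 0 \<longrightarrow> singular_simplex p X f) \<and> finite {p. a p \<noteq> (\<lambda>f. 0)}}"

definition coboundary :: "'b topology \<Rightarrow> 'b cochain \<Rightarrow> 'b cochain" where
  "coboundary X a = (\<lambda>p f.
     if p \<noteq> 0 \<and> singular_simplex p X f
     then (\<Sum>k\<le>p. a (p - 1) (singular_face p k f)) else 0)"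

definition cocycles :: "'b topology \<Rightarrow> 'b cochain set" where
  "cocycles X = {a \<in> cochains X. coboundary X a = (\<lambda>p f. 0)}"

definition coboundaries :: "'b topology \<Rightarrow> 'b cochain set" where
  "coboundaries X = coboundary X ` cochains X"

definition front_face :: "nat \<Rightarrow> ((nat \<Rightarrow> real) \<Rightarrow> 'b) \<Rightarrow> (nat \<Rightarrow> real) \<Rightarrow> 'b" where
  "front_face p f = restrict f (standard_simplex p)"

text \<open>The face of dimension \<open>q\<close> spanned by the vertices \<open>p, \<dots>, p + q\<close>.\<close>

definition back_face :: "nat \<Rightarrow> nat \<Rightarrow> ((nat \<Rightarrow> real) \<Rightarrow> 'b) \<Rightarrow> (nat \<Rightarrow> real) \<Rightarrow> 'b" where
  "back_face p q f =
     restrict (\<lambda>x. f (\<lambda>i. if i < p then 0 else x (i - p))) (standard_simplex q)"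

definition cup :: "'b topology \<Rightarrow> 'b cochain \<Rightarrow> 'b cochain \<Rightarrow> 'b cochain" where
  "cup X a b = (\<lambda>m f.
     if singular_simplex m X f
     then (\<Sum>p\<le>m. a p (front_face p f) * b (m - p) (back_face p (m - p) f)) else 0)"

definition cocycle_ring :: "'b topology \<Rightarrow> 'b cochain ring" where
  "cocycle_ring X =
     \<lparr>carrier = cocycles X,
      monoid.mult = cup X,
      one = (\<lambda>p f. if p = 0 \<and> singular_simplex 0 X f then 1 else 0),
      zero = (\<lambda>p f. 0),
      add = (\<lambda>a b p f. a p f + b p f)\<rparr>"

definition cohomology_ring :: "'b topology \<Rightarrow> 'b cochain set ring" where
  "cohomology_ring X = cocycle_ring X Quot coboundaries X"

definition cohomology_class :: "'b topology \<Rightarrow> 'b cochain \<Rightarrow> 'b cochain set" where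
  "cohomology_class X a = coboundaries X +>\<^bsub>cocycle_ring X\<^esub> a"

definition cohomology_group :: "nat \<Rightarrow> 'b topology \<Rightarrow> 'b cochain set set" where
  "cohomology_group p X = cohomology_class X ` {a \<in> cocycles X. \<forall>q. q \<noteq> p \<longrightarrow> a q = (\<lambda>f. 0)}"

text \<open>As for \<^const>\<open>rcoset_mult\<close>, the two operations below are unions over all representatives;
  all members of such a union are equal.\<close>

definition homogeneous_part :: "'b topology \<Rightarrow> nat \<Rightarrow> 'b cochain set \<Rightarrow> 'b cochain set" where
  "homogeneous_part X p x =
     (\<Union>a\<in>x. cohomology_class X (\<lambda>q. if q = p then a q else (\<lambda>f. 0)))"

definition cohomology_pullback ::
    "'b topology \<Rightarrow> ('b \<Rightarrow> 'c) \<Rightarrow> 'c cochain set \<Rightarrow> 'b cochain set" where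
  "cohomology_pullback X g x =
     (\<Union>a\<in>x. cohomology_class X
        (\<lambda>p f. if singular_simplex p X f then a p (simplex_map p g f) else 0))"


section \<open>Stiefel-Whitney classes\<close>

text \<open>A real vector bundle enters through its base \<open>X\<close>, its total space \<open>E\<close>, its projection
  \<open>\<pi>\<close>, its fibrewise scalar multiplication \<open>s\<close> and its rank \<open>r\<close>.  Its projectivization is the
  quotient of the space of nonzero vectors by the nonzero scalars.\<close>

definition nonzero_vectors :: "'e topology \<Rightarrow> (real \<Rightarrow> 'e \<Rightarrow> 'e) \<Rightarrow> 'e topology" where
  "nonzero_vectors E s = subtopology E {e. s 0 e \<noteq> e}"

definition line_through :: "(real \<Rightarrow> 'e \<Rightarrow> 'e) \<Rightarrow> 'e \<Rightarrow> 'e set" where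
  "line_through s e = {s c e | c. c \<noteq> 0}"

definition projectivization :: "'e topology \<Rightarrow> (real \<Rightarrow> 'e \<Rightarrow> 'e) \<Rightarrow> 'e set topology" where
  "projectivization E s = quotient_topology (nonzero_vectors E s) (line_through s)"

definition projectivization_proj :: "('e \<Rightarrow> 'b) \<Rightarrow> 'e set \<Rightarrow> 'b" where
  "projectivization_proj \<pi> L = \<pi> (SOME e. e \<in> L)"

text \<open>The first Stiefel-Whitney class of the tautological line bundle over the projectivization.
  It is the class of the double cover formed by the two orientations of each line, that is, the
  class whose value on a loop of lines is 0 iff the loop lifts to a path of nonzero vectors
  ending at a positive multiple of its starting point.  To get a cocycle, every line is oriented
  by an arbitrary choice of one of its nonzero vectors; other choices change it by a coboundary.\<close>

definition simplex_vertex :: "nat \<Rightarrow> nat \<Rightarrow> real" where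
  "simplex_vertex i = (\<lambda>j. if j = i then 1 else 0)"

definition orientation_preserving ::
    "'e topology \<Rightarrow> (real \<Rightarrow> 'e \<Rightarrow> 'e) \<Rightarrow> ((nat \<Rightarrow> real) \<Rightarrow> 'e set) \<Rightarrow> bool" where
  "orientation_preserving E s f \<longleftrightarrow>
     (\<exists>g. singular_simplex 1 (nonzero_vectors E s) g \<and> simplex_map 1 (line_through s) g = f \<and>
        (\<forall>i\<in>{0, 1}. \<exists>c>0. g (simplex_vertex i) = s c (SOME e. e \<in> f (simplex_vertex i))))"

definition tautological_class ::
    "'e topology \<Rightarrow> (real \<Rightarrow> 'e \<Rightarrow> 'e) \<Rightarrow> 'e set cochain set" where
  "tautological_class E s = cohomology_class (projectivization E s)
     (\<lambda>p f. if p = 1 \<and> singular_simplex 1 (projectivization E s) f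
               \<and> \<not> orientation_preserving E s f then 1 else 0)"

text \<open>The total Stiefel-Whitney class \<open>1 + w\<^sub>1 + \<dots> + w\<^sub>r\<close>, with the \<open>w\<^sub>i\<close> defined as the
  coefficients of the relation \<open>x\<^sup>r + w\<^sub>1 x\<^sup>r\<^sup>-\<^sup>1 + \<dots> + w\<^sub>r = 0\<close> satisfied by the tautological
  class \<open>x\<close> of the projectivization (the projective bundle theorem).\<close>

definition total_SW_class ::
    "'b topology \<Rightarrow> 'e topology \<Rightarrow> ('e \<Rightarrow> 'b) \<Rightarrow> (real \<Rightarrow> 'e \<Rightarrow> 'e) \<Rightarrow> nat \<Rightarrow> 'b cochain set" where
  "total_SW_class X E \<pi> s r = (THE w.
     w \<in> carrier (cohomology_ring X) \<and>
     homogeneous_part X 0 w = \<one>\<^bsub>cohomology_ring X\<^esub> \<and>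
     (\<forall>i>r. homogeneous_part X i w = \<zero>\<^bsub>cohomology_ring X\<^esub>) \<and>
     (\<Oplus>\<^bsub>cohomology_ring (projectivization E s)\<^esub>i\<in>{..r}.
        cohomology_pullback (projectivization E s) (projectivization_proj \<pi>)
            (homogeneous_part X i w)
        \<otimes>\<^bsub>cohomology_ring (projectivization E s)\<^esub>
        (tautological_class E s [^]\<^bsub>cohomology_ring (projectivization E s)\<^esub> (r - i)))
     = \<zero>\<^bsub>cohomology_ring (projectivization E s)\<^esub>)"


section \<open>Smooth atlases and tangent bundles\<close>

text \<open>Only used on open sets.\<close>

primrec C_k_on :: "nat \<Rightarrow> 'a::real_normed_vector set \<Rightarrow> ('a \<Rightarrow> 'b::real_normed_vector) \<Rightarrow> bool" where
  "C_k_on 0 S f \<longleftrightarrow> continuous_on S f"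
| "C_k_on (Suc k) S f \<longleftrightarrow>
     (\<forall>x\<in>S. f differentiable (at x)) \<and> (\<forall>v. C_k_on k S (\<lambda>x. frechet_derivative f (at x) v))"

definition smooth_on :: "'a::real_normed_vector set \<Rightarrow> ('a \<Rightarrow> 'b::real_normed_vector) \<Rightarrow> bool" where
  "smooth_on S f \<longleftrightarrow> (\<forall>k. C_k_on k S f)"

type_synonym ('b, 'e) chart = "'b set \<times> ('b \<Rightarrow> 'e)"

definition transition :: "('b, 'e) chart \<Rightarrow> ('b, 'e) chart \<Rightarrow> 'e \<Rightarrow> 'e" where
  "transition c c' = snd c' \<circ> inv_into (fst c) (snd c)"

definition smooth_atlas :: "'b topology \<Rightarrow> ('b, 'e::euclidean_space) chart set \<Rightarrow> bool" where
  "smooth_atlas X A \<longleftrightarrow>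
     (\<Union>c\<in>A. fst c) = topspace X \<and>
     (\<forall>(U, \<phi>)\<in>A. openin X U \<and> open (\<phi> ` U) \<and>
        homeomorphic_map (subtopology X U) (top_of_set (\<phi> ` U)) \<phi>) \<and>
     (\<forall>c\<in>A. \<forall>c'\<in>A. smooth_on (snd c ` (fst c \<inter> fst c')) (transition c c'))"

text \<open>A tangent vector at \<open>p\<close> is the family of its coordinate vectors in all the charts
  around \<open>p\<close> (and \<open>0\<close> for the other arguments), related by the derivatives of the
  transition maps.\<close>

definition tangent_vectors ::
    "('b, 'e::euclidean_space) chart set \<Rightarrow> ('b \<times> (('b, 'e) chart \<Rightarrow> 'e)) set" where
  "tangent_vectors A = {(p, v). p \<in> (\<Union>c\<in>A. fst c) \<and>
     (\<forall>c. c \<in> A \<and> p \<in> fst c \<or> v c = 0) \<and>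
     (\<forall>c\<in>A. \<forall>c'\<in>A. p \<in> fst c \<inter> fst c' \<longrightarrow>
        v c' = frechet_derivative (transition c c') (at (snd c p)) (v c))}"

definition tangent_bundle ::
    "('b, 'e::euclidean_space) chart set \<Rightarrow> ('b \<times> (('b, 'e) chart \<Rightarrow> 'e)) topology" where
  "tangent_bundle A = topology_generated_by
     {{(p, v) \<in> tangent_vectors A. p \<in> fst c \<and> (snd c p, v c) \<in> W} | c W. c \<in> A \<and> open W}"

definition tangent_scale ::
    "real \<Rightarrow> 'b \<times> (('b, 'e::euclidean_space) chart \<Rightarrow> 'e) \<Rightarrow> 'b \<times> (('b, 'e) chart \<Rightarrow> 'e)" where
  "tangent_scale c = (\<lambda>(p, v). (p, \<lambda>x. c *\<^sub>R v x))"

definition manifold_SW_class ::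
    "'b topology \<Rightarrow> ('b, 'e::euclidean_space) chart set \<Rightarrow> 'b cochain set" where
  "manifold_SW_class X A = total_SW_class X (tangent_bundle A) fst tangent_scale DIM('e)"

definition dual_SW_class ::
    "'b topology \<Rightarrow> ('b, 'e::euclidean_space) chart set \<Rightarrow> 'b cochain set" where
  "dual_SW_class X A = inv\<^bsub>cohomology_ring X\<^esub> (manifold_SW_class X A)"


section \<open>Coloured simple polytopes\<close>

definition facets :: "'a::euclidean_space set \<Rightarrow> 'a set set" where
  "facets P = {F. F facet_of P}"

definition simple_polytope :: "nat \<Rightarrow> 'a::euclidean_space set \<Rightarrow> bool" where
  "simple_polytope n P \<longleftrightarrow> polytope P \<and> aff_dim P = int n \<and>
     (\<forall>V. V extreme_point_of P \<longrightarrow> card {F \<in> facets P. V \<in> F} = n)"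

definition proper_coloring :: "nat \<Rightarrow> 'a::euclidean_space set \<Rightarrow> ('a set \<Rightarrow> nat) \<Rightarrow> bool" where
  "proper_coloring n P h \<longleftrightarrow> h ` facets P \<subseteq> {1..n} \<and>
     (\<forall>F\<in>facets P. \<forall>F'\<in>facets P. F \<noteq> F' \<and> F \<inter> F' \<noteq> {} \<longrightarrow> h F \<noteq> h F')"

definition base_vertex ::
    "nat \<Rightarrow> 'a::euclidean_space set \<Rightarrow> ('a set \<Rightarrow> nat) \<Rightarrow> 'a \<Rightarrow> (nat \<Rightarrow> 'a set) \<Rightarrow> bool" where
  "base_vertex n P h V H \<longleftrightarrow> V extreme_point_of P \<and>
     (\<forall>i\<in>{1..n}. H i \<in> facets P \<and> h (H i) = i) \<and> (\<Inter>i\<in>{1..n}. H i) = {V}"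

text \<open>The \<open>i\<close>-th entry of the vector assigned to the facet \<open>F\<close>.  All entries are 0 or 1, so
  they are natural numbers for both values of \<open>d\<close>.\<close>

definition char_vector :: "('a set \<Rightarrow> nat) \<Rightarrow> (nat \<Rightarrow> 'a set) \<Rightarrow> 'a set \<Rightarrow> nat \<Rightarrow> nat" where
  "char_vector h H F i =
     (if F = H (h F) then (if h F \<le> i then 1 else 0) else (if i = h F then 1 else 0))"


section \<open>The manifolds\<close>

definition sphere_set :: "nat \<Rightarrow> complex set" where
  "sphere_set d = (if d = 1 then {1, -1} else sphere 0 1)"

definition sphere_group :: "nat \<Rightarrow> complex monoid" where
  "sphere_group d = \<lparr>carrier = sphere_set d, monoid.mult = (*), one = 1\<rparr>"

definition torus_group :: "nat \<Rightarrow> nat \<Rightarrow> (nat \<Rightarrow> complex) monoid" where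
  "torus_group d n = product_group {1..n} (\<lambda>i. sphere_group d)"

definition torus_topology :: "nat \<Rightarrow> nat \<Rightarrow> (nat \<Rightarrow> complex) topology" where
  "torus_topology d n = product_topology (\<lambda>i. top_of_set (sphere_set d)) {1..n}"

definition char_subgroup :: "nat \<Rightarrow> nat \<Rightarrow> (nat \<Rightarrow> nat) \<Rightarrow> (nat \<Rightarrow> complex) set" where
  "char_subgroup d n l =
     (if d = 1 then {\<lambda>i\<in>{1..n}. 1, \<lambda>i\<in>{1..n}. (-1) ^ l i}
      else {\<lambda>i\<in>{1..n}. exp (2 * pi * \<i> * of_nat (l i) * of_real t) | t :: real. True})"

definition isotropy_group ::
    "nat \<Rightarrow> nat \<Rightarrow> 'a::euclidean_space set \<Rightarrow> ('a set \<Rightarrow> nat \<Rightarrow> nat) \<Rightarrow> 'a \<Rightarrow> (nat \<Rightarrow> complex) set" where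
  "isotropy_group d n P l q =
     generate (torus_group d n) (\<Union>F\<in>{F \<in> facets P. q \<in> F}. char_subgroup d n (l F))"

definition toric_relation ::
    "nat \<Rightarrow> nat \<Rightarrow> 'a::euclidean_space set \<Rightarrow> ('a set \<Rightarrow> nat \<Rightarrow> nat) \<Rightarrow>
     (((nat \<Rightarrow> complex) \<times> 'a) \<times> ((nat \<Rightarrow> complex) \<times> 'a)) set" where
  "toric_relation d n P l = {((t1, p), (t2, q)).
     t1 \<in> carrier (torus_group d n) \<and> t2 \<in> carrier (torus_group d n) \<and> p \<in> P \<and> q \<in> P \<and>
     p = q \<and> t1 \<otimes>\<^bsub>torus_group d n\<^esub> inv\<^bsub>torus_group d n\<^esub> t2 \<in> isotropy_group d n P l q}"

definition toric_space ::
    "nat \<Rightarrow> nat \<Rightarrow> 'a::euclidean_space set \<Rightarrow> ('a set \<Rightarrow> nat \<Rightarrow> nat) \<Rightarrow>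
     ((nat \<Rightarrow> complex) \<times> 'a) set topology" where
  "toric_space d n P l =
     quotient_topology (prod_topology (torus_topology d n) (top_of_set P))
       (\<lambda>x. toric_relation d n P l `` {x})"

definition toric_action ::
    "nat \<Rightarrow> nat \<Rightarrow> (nat \<Rightarrow> complex) \<Rightarrow> ((nat \<Rightarrow> complex) \<times> 'a) set \<Rightarrow> ((nat \<Rightarrow> complex) \<times> 'a) set" where
  "toric_action d n g x = (\<lambda>(t, p). (g \<otimes>\<^bsub>torus_group d n\<^esub> t, p)) ` x"

text \<open>Real-linear coordinates that identify the model space \<open>'e\<close> of the charts with
  \<open>\<real>\<^sup>n\<close> (\<open>d = 1\<close>) or \<open>\<complex>\<^sup>n\<close> (\<open>d = 2\<close>), the coordinates being indexed by \<open>1, \<dots>, n\<close>.\<close>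

definition linear_coordinates :: "nat \<Rightarrow> nat \<Rightarrow> ('e::euclidean_space \<Rightarrow> nat \<Rightarrow> complex) \<Rightarrow> bool" where
  "linear_coordinates d n z \<longleftrightarrow> (\<forall>i\<in>{1..n}. linear (\<lambda>x. z x i)) \<and>
     bij_betw (\<lambda>x. restrict (z x) {1..n}) UNIV
       (\<Pi>\<^sub>E i\<in>{1..n}. if d = 1 then \<real> else UNIV)"

text \<open>Around every point there is an invariant chart \<open>(U, \<phi>)\<close> of the smooth structure given by
  the atlas in which the action becomes, up to an automorphism \<open>\<theta>\<close> of the (Lie) group, the
  coordinatewise action.\<close>

definition locally_standard ::
    "nat \<Rightarrow> nat \<Rightarrow> 'b topology \<Rightarrow> ('b, 'e::euclidean_space) chart set \<Rightarrow>
     ((nat \<Rightarrow> complex) \<Rightarrow> 'b \<Rightarrow> 'b) \<Rightarrow> bool" where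
  "locally_standard d n X A act \<longleftrightarrow>
     (\<forall>x\<in>topspace X. \<exists>U \<phi> \<theta> z.
        x \<in> U \<and> smooth_atlas X (insert (U, \<phi>) A) \<and>
        \<theta> \<in> iso (torus_group d n) (torus_group d n) \<and>
        homeomorphic_map (torus_topology d n) (torus_topology d n) \<theta> \<and>
        linear_coordinates d n z \<and>
        (\<forall>g\<in>carrier (torus_group d n). \<forall>y\<in>U.
           act g y \<in> U \<and> (\<forall>i\<in>{1..n}. z (\<phi> (act g y)) i = \<theta> g i * z (\<phi> y) i)))"


section \<open>The Davis-Januszkiewicz presentation\<close>

type_synonym 'v bit_poly = "('v \<Rightarrow>\<^sub>0 nat) \<Rightarrow>\<^sub>0 bit"

definition poly_var :: "'v \<Rightarrow> 'v bit_poly" where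
  "poly_var x = Poly_Mapping.single (Poly_Mapping.single x 1) 1"

definition polynomial_ring :: "'v set \<Rightarrow> 'v bit_poly ring" where
  "polynomial_ring S =
     \<lparr>carrier = {p. \<forall>m\<in>Poly_Mapping.keys p. Poly_Mapping.keys m \<subseteq> S},
      monoid.mult = (*), one = 1, zero = 0, add = (+)\<rparr>"

definition nonface_monomials :: "'a::euclidean_space set \<Rightarrow> 'a set bit_poly set" where
  "nonface_monomials P = {\<Prod>F\<in>S. poly_var F | S. S \<subseteq> facets P \<and> \<Inter>S = {}}"

definition linear_forms ::
    "nat \<Rightarrow> 'a::euclidean_space set \<Rightarrow> ('a set \<Rightarrow> nat) \<Rightarrow> (nat \<Rightarrow> 'a set) \<Rightarrow> 'a set bit_poly set" where
  "linear_forms n P h H =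
     {(\<Sum>j=1..i. poly_var (H j)) + (\<Sum>F\<in>{F \<in> facets P. h F = i} - {H i}. poly_var F)
      | i. i \<in> {1..n}}"

text \<open>The ring \<open>R\<close> is the quotient of the polynomial ring in the facets by the ideal of
  relations, the variable of a facet \<open>F\<close> being mapped to \<open>v F\<close>.\<close>

definition presented_by_facets ::
    "nat \<Rightarrow> 'a::euclidean_space set \<Rightarrow> ('a set \<Rightarrow> nat) \<Rightarrow> (nat \<Rightarrow> 'a set) \<Rightarrow>
     ('r, 's) ring_scheme \<Rightarrow> ('a set \<Rightarrow> 'r) \<Rightarrow> bool" where
  "presented_by_facets n P h H R v \<longleftrightarrow>
     (\<exists>\<Phi>\<in>ring_hom (polynomial_ring (facets P)) R.
        (\<forall>F\<in>facets P. \<Phi> (poly_var F) = v F) \<and>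
        \<Phi> ` carrier (polynomial_ring (facets P)) = carrier R \<and>
        a_kernel (polynomial_ring (facets P)) R \<Phi> =
          Idl\<^bsub>polynomial_ring (facets P)\<^esub> (nonface_monomials P \<union> linear_forms n P h H))"

end

theory Submission
  imports Defs
begin

text \<open>Write \<open>u\<^sub>i\<close> for the class of \<open>H\<^sub>i\<close> and \<open>s\<^sub>i = u\<^sub>1 + \<dots> + u\<^sub>i\<close>.  Distinct facets of the same colour are
  disjoint, so the linear relations give \<open>u\<^sub>i s\<^sub>i = 0\<close>, that is \<open>s\<^sub>i\<^sup>2 = s\<^sub>i s\<^sub>i\<^sub>-\<^sub>1\<close>, and the factors of \<open>w\<close>
  that belong to the colour \<open>i\<close> multiply to \<open>1 + u\<^sub>i + s\<^sub>i = 1 + s\<^sub>i\<^sub>-\<^sub>1\<close>.  Hence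
  \<open>w = (1 + s\<^sub>1) \<dots> (1 + s\<^sub>n\<^sub>-\<^sub>1)\<close>.  The part of degree \<open>n - 1\<close> of its inverse is
  \<open>s\<^sub>1 \<dots> s\<^sub>n\<^sub>-\<^sub>1 = u\<^sub>1 \<dots> u\<^sub>n\<^sub>-\<^sub>1\<close> times a Catalan number, which is odd because \<open>n\<close> is a power of two.
  Finally \<open>u\<^sub>1 \<dots> u\<^sub>n\<close> is not a relation: each squarefree monomial of a vertex counts 1, and this counting
  functional extends to the quotient because an edge of \<open>P\<close> has two vertices.\<close>

section \<open>Edges of simple polytopes\<close>

text \<open>The functional that counts vertices is natural on squarefree monomials only; elsewhere
  its values are forced by rewriting squares, and the obstacle is that different orders of rewriting
  must agree. Letting every variable act on functions of facet sets turns this confluence into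
  commutation of operators; the polynomials that annihilate the counting function then form an ideal
  at once. The parity of the Catalan number enters through a recursion over powers of two: a product
  of m factors contributes a term of degree m - 1 to its inverse only if m is itself a power of two.
  Degrees are read off cochain representatives, since the presentation by itself says nothing about
  the grading; the ring laws of cohomology are carried over from the polynomial ring along the
  surjection that the presentation provides.\<close>

lemma finite_facets: "polytope P \<Longrightarrow> finite (facets P)"
  unfolding facets_def by (rule finite_polytope_facets)

text \<open>The region cut out by one supporting hyperplane per facet is compared with \<open>P\<close> along rays
  from a relative interior point.\<close>

lemma polytope_facet_description:
  fixes P :: "'a::euclidean_space set"
  assumes P: "polytope P"
  obtains a :: "'a set \<Rightarrow> 'a" and b :: "'a set \<Rightarrow> real" where
    "\<And>F. F \<in> facets P \<Longrightarrow> F = P \<inter> {x. a F \<bullet> x = b F}"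
    "\<And>F x. F \<in> facets P \<Longrightarrow> x \<in> P \<Longrightarrow> a F \<bullet> x \<le> b F"
    "\<And>x. x \<in> affine hull P \<Longrightarrow> (\<And>F. F \<in> facets P \<Longrightarrow> a F \<bullet> x \<le> b F) \<Longrightarrow> x \<in> P"
proof -
  have poly: "polyhedron P"
    using P by (rule polytope_imp_polyhedron)
  have "\<exists>a b. P \<subseteq> {x. a \<bullet> x \<le> b} \<and> F = P \<inter> {x. a \<bullet> x = b}" if "F \<in> facets P" for F
    using that facet_of_polyhedron[OF poly] unfolding facets_def by (metis mem_Collect_eq)
  then obtain a b where ab: "\<And>F. F \<in> facets P \<Longrightarrow> P \<subseteq> {x. a F \<bullet> x \<le> b F} \<and> F = P \<inter> {x. a F \<bullet> x = b F}"
    by metis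
  have "z \<in> P" if z: "z \<in> affine hull P" and le: "\<And>F. F \<in> facets P \<Longrightarrow> a F \<bullet> z \<le> b F" for z
  proof (cases "P = {} \<or> z \<in> rel_interior P")
    case True
    then show ?thesis
      using z rel_interior_subset by auto
  next
    case False
    then obtain p where p: "p \<in> rel_interior P"
      using rel_interior_eq_empty[of P] polytope_imp_convex[OF P] by auto
    then have pP: "p \<in> P"
      using rel_interior_subset by auto
    have "z - p \<noteq> 0"
      using False p by auto
    then obtain t where t: "0 < t" "p + t *\<^sub>R (z - p) \<in> rel_frontier P"
        "\<And>e. 0 \<le> e \<Longrightarrow> e < t \<Longrightarrow> p + e *\<^sub>R (z - p) \<in> rel_interior P"
      using ray_to_rel_frontier[of P p "z - p"] polytope_imp_bounded[OF P] p z by auto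
    define y where "y = p + t *\<^sub>R (z - p)"
    have y: "y \<in> P - rel_interior P"
      using t(2) polytope_imp_closed[OF P] by (simp add: y_def rel_frontier_def)
    then obtain F where F: "F \<in> facets P" "y \<in> F"
      using rel_interior_of_polyhedron[OF poly] by (auto simp: facets_def)
    have "p \<notin> F"
      using p rel_interior_of_polyhedron[OF poly] F by (auto simp: facets_def)
    then have strict: "a F \<bullet> p < b F"
      using ab[OF F(1)] pP by force
    have "a F \<bullet> y = b F"
      using ab[OF F(1)] F(2) by auto
    then have eq: "t * (a F \<bullet> z - a F \<bullet> p) = b F - a F \<bullet> p"
      by (simp add: y_def inner_add_right inner_diff_right)
    \<comment> \<open>The slack of \<open>F\<close> along the ray is affine, positive at
      \<open>p\<close> and zero at the exit point; since \<open>z\<close> has nonnegative slack, the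
      exit does not come before \<open>z\<close>.\<close>
    have "t \<ge> 1"
    proof (rule ccontr)
      assume "\<not> t \<ge> 1"
      then have "t * (b F - a F \<bullet> p) < b F - a F \<bullet> p"
        using strict by simp
      moreover have "t * (a F \<bullet> z - a F \<bullet> p) \<le> t * (b F - a F \<bullet> p)"
        using le[OF F(1)] t(1) by simp
      ultimately show False
        using eq by simp
    qed
    then show ?thesis
      using t(3)[of 1] False y by (cases "t = 1") (auto simp: y_def)
  qed
  then show thesis
    using that[of a b] ab by blast
qed

text \<open>Each hyperplane lowers the dimension by at most one; the common point \<open>w\<close>
  excludes an empty intersection, where the dimension would drop to -1.\<close>

lemma aff_dim_Int_hyperplanes:
  fixes S :: "'a::euclidean_space set"
  assumes "finite A" "affine S" "w \<in> S" "\<And>F. F \<in> A \<Longrightarrow> a F \<bullet> w = b F"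
  shows "aff_dim (S \<inter> {x. \<forall>F\<in>A. a F \<bullet> x = b F}) \<ge> aff_dim S - int (card A)"
  using assms(1,4)
proof (induction A rule: finite_induct)
  case empty
  then show ?case by simp
next
  case (insert G A)
  define T where "T = S \<inter> {x. \<forall>F\<in>A. a F \<bullet> x = b F}"
  have "{x. \<forall>F\<in>A. a F \<bullet> x = b F} = (\<Inter>F\<in>A. {x. a F \<bullet> x = b F})"
    by auto
  then have "affine T"
    unfolding T_def using assms(2) by (auto intro!: affine_Int affine_Inter affine_hyperplane)
  moreover have "w \<in> T \<inter> {x. a G \<bullet> x = b G}"
    using insert.prems assms(3) by (auto simp: T_def)
  ultimately have "aff_dim (T \<inter> {x. a G \<bullet> x = b G}) \<ge> aff_dim T - 1"
    by (subst aff_dim_affine_Int_hyperplane) auto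
  moreover have "S \<inter> {x. \<forall>F\<in>insert G A. a F \<bullet> x = b F} = T \<inter> {x. a G \<bullet> x = b G}"
    by (auto simp: T_def)
  moreover have "aff_dim T \<ge> aff_dim S - int (card A)"
    using insert.IH insert.prems by (simp add: T_def)
  ultimately show ?case
    using insert.hyps by simp
qed

text \<open>The facets in \<open>S\<close> cut out a face \<open>E\<close> that is an edge by a
  dimension count, and by simplicity each of its two ends lies on exactly one facet outside
  \<open>S\<close>. This is the count that vanishes modulo 2 in the linear relations.\<close>

proposition simple_polytope_edge:
  fixes P :: "'a::euclidean_space set"
  assumes P: "simple_polytope n P" and n: "n \<ge> 1"
    and S: "S \<subseteq> facets P" "card S = n - 1" and x0: "x0 \<in> P" "\<And>F. F \<in> S \<Longrightarrow> x0 \<in> F"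
  shows "card {G \<in> facets P. G \<notin> S \<and> (\<exists>x\<in>P. \<forall>F\<in>insert G S. x \<in> F)} = 2"
proof -
  have pol: "polytope P" and dimP: "aff_dim P = int n"
    and vert: "\<And>V. V extreme_point_of P \<Longrightarrow> card {F \<in> facets P. V \<in> F} = n"
    using P by (auto simp: simple_polytope_def)
  note fin = finite_facets[OF pol]
  have finS: "finite S"
    using S(1) fin finite_subset by blast
  obtain a b where F_eq: "\<And>F. F \<in> facets P \<Longrightarrow> F = P \<inter> {x. a F \<bullet> x = b F}"
    and le: "\<And>F x. F \<in> facets P \<Longrightarrow> x \<in> P \<Longrightarrow> a F \<bullet> x \<le> b F"
    and in_P: "\<And>x. x \<in> affine hull P \<Longrightarrow> (\<And>F. F \<in> facets P \<Longrightarrow> a F \<bullet> x \<le> b F) \<Longrightarrow> x \<in> P"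
    by (rule polytope_facet_description[OF pol], rule that) blast+
  have mem_iff: "x \<in> F \<longleftrightarrow> x \<in> P \<and> a F \<bullet> x = b F" if "F \<in> facets P" for F x
    using F_eq[OF that] by blast

  \<comment> \<open>Facets that miss \<open>w\<close> have slack there and do not obstruct small
    \<open>t\<close>; only the facets through \<open>w\<close> restrict the direction.\<close>
  have local_P: "\<exists>e>0. \<forall>t. 0 < t \<and> t \<le> e \<longrightarrow> w + t *\<^sub>R u \<in> P"
    if w: "w \<in> P" and u: "w + u \<in> affine hull P"
      and act: "\<And>F. F \<in> facets P \<Longrightarrow> w \<in> F \<Longrightarrow> a F \<bullet> u \<le> 0" for w u
  proof -
    have "eventually (\<lambda>t. a F \<bullet> (w + t *\<^sub>R u) \<le> b F) (at_right 0)" if F: "F \<in> facets P" for F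
    proof (cases "w \<in> F")
      case True
      then have "a F \<bullet> (w + t *\<^sub>R u) \<le> b F" if "t > 0" for t
        using act[OF F True] mem_iff[OF F] that
        by (auto simp: inner_add_right mult_nonneg_nonpos)
      then show ?thesis
        by (auto simp: eventually_at_right_less intro: eventually_mono[OF eventually_at_right_less])
    next
      case False
      then have "a F \<bullet> w < b F"
        using mem_iff[OF F] le[OF F w] w by force
      moreover have "((\<lambda>t. a F \<bullet> (w + t *\<^sub>R u)) \<longlongrightarrow> a F \<bullet> (w + 0 *\<^sub>R u)) (at_right 0)"
        by (intro tendsto_intros)
      ultimately have "eventually (\<lambda>t. a F \<bullet> (w + t *\<^sub>R u) < b F) (at_right 0)"
        by (intro order_tendstoD(2)[of _ "a F \<bullet> (w + 0 *\<^sub>R u)"]) auto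
      then show ?thesis
        by (rule eventually_mono) simp
    qed
    then have "eventually (\<lambda>t. \<forall>F\<in>facets P. a F \<bullet> (w + t *\<^sub>R u) \<le> b F) (at_right 0)"
      using fin by (simp add: eventually_ball_finite)
    then obtain e where e: "e > 0" "\<And>t F. 0 < t \<Longrightarrow> t < e \<Longrightarrow> F \<in> facets P \<Longrightarrow> a F \<bullet> (w + t *\<^sub>R u) \<le> b F"
      by (auto simp: eventually_at_right_field)
    have aff: "w + t *\<^sub>R u \<in> affine hull P" for t
    proof -
      have "w \<in> affine hull P"
        using w by (rule hull_inc)
      then have "(1 - t) *\<^sub>R w + t *\<^sub>R (w + u) \<in> affine hull P"
        by (intro mem_affine[OF affine_affine_hull _ u]) auto
      then show ?thesis
        by (simp add: algebra_simps)
    qed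
    have "w + t *\<^sub>R u \<in> P" if "0 < t" "t \<le> e / 2" for t
      using in_P[OF aff] e that by auto
    then show ?thesis
      using e(1) by (intro exI[of _ "e / 2"]) auto
  qed

  have reflect: "w - u \<in> affine hull P" if "w \<in> P" "w + u \<in> affine hull P" for w u
  proof -
    have "2 *\<^sub>R w + (-1) *\<^sub>R (w + u) \<in> affine hull P"
      using that hull_inc[of w P affine] by (intro mem_affine[OF affine_affine_hull]) auto
    then show ?thesis
      by (simp add: scaleR_2)
  qed

  \<comment> \<open>Otherwise both directions along y - w stay in \<open>P\<close> for a short time,
    and the vertex \<open>w\<close> would be a midpoint.\<close>
  have uniq: "y = w"
    if w: "w extreme_point_of P" and y: "y \<in> affine hull P"
      and act: "\<And>F. F \<in> facets P \<Longrightarrow> w \<in> F \<Longrightarrow> a F \<bullet> y = b F" for w y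
  proof (rule ccontr)
    assume ne: "y \<noteq> w"
    define u where "u = y - w"
    have wP: "w \<in> P"
      using w by (simp add: extreme_point_of_def)
    have yu: "w + u \<in> affine hull P"
      using y by (simp add: u_def)
    have zero: "a F \<bullet> u = 0" if "F \<in> facets P" "w \<in> F" for F
      using act[OF that] that mem_iff by (auto simp: u_def inner_diff_right)
    obtain e1 where e1: "e1 > 0" "\<And>t. 0 < t \<Longrightarrow> t \<le> e1 \<Longrightarrow> w + t *\<^sub>R u \<in> P"
      using local_P[OF wP yu] zero by force
    obtain e2 where e2: "e2 > 0" "\<And>t. 0 < t \<Longrightarrow> t \<le> e2 \<Longrightarrow> w + t *\<^sub>R (- u) \<in> P"
      using local_P[OF wP, of "- u"] reflect[OF wP yu] zero by force
    define e where "e = min e1 e2"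
    have e: "e > 0" "w + e *\<^sub>R u \<in> P" "w + e *\<^sub>R (- u) \<in> P"
      using e1 e2 by (auto simp: e_def)
    have "w = midpoint (w + e *\<^sub>R u) (w + e *\<^sub>R (- u))"
      by (simp add: midpoint_def scaleR_2[symmetric])
    moreover have "w + e *\<^sub>R u \<noteq> w + e *\<^sub>R (- u)"
    proof
      assume "w + e *\<^sub>R u = w + e *\<^sub>R (- u)"
      then have "(2 * e) *\<^sub>R u = 0"
        by (metis add.commute add_right_imp_eq diff_add_cancel diff_minus_eq_add mult_2 scaleR_add_left
            scaleR_minus_right diff_self add.right_inverse add_left_cancel)
      then show False
        using e(1) ne by (simp add: u_def)
    qed
    ultimately have "w \<in> open_segment (w + e *\<^sub>R u) (w + e *\<^sub>R (- u))"
      using midpoint_in_open_segment by metis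
    then show False
      using w e by (auto simp: extreme_point_of_def)
  qed

  define Z where "Z = affine hull P \<inter> {x. \<forall>F\<in>S. a F \<bullet> x = b F}"
  define E where "E = {x \<in> P. \<forall>F\<in>S. x \<in> F}"
  have mem_iff_S: "x \<in> F \<longleftrightarrow> x \<in> P \<and> a F \<bullet> x = b F" if "F \<in> S" for F x
    using S(1) that mem_iff by blast
  have E_Z: "E = P \<inter> Z"
    using mem_iff_S hull_subset[of P affine] by (auto simp: E_def Z_def)
  have E_face: "E face_of P"
  proof -
    have "\<Inter>(insert P S) face_of P"
      using S(1) polytope_imp_convex[OF pol]
      by (intro face_of_Inter) (auto simp: facets_def facet_of_def face_of_refl)
    moreover have "\<Inter>(insert P S) = E"
      by (auto simp: E_def)
    ultimately show ?thesis
      by simp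
  qed
  have "compact E" "convex E"
    using E_face pol face_of_imp_compact face_of_imp_convex polytope_imp_compact polytope_imp_convex
    by blast+
  have "x0 \<in> E"
    using x0 by (simp add: E_def)
  then obtain w where "w extreme_point_of E"
    using extreme_point_exists_convex[OF \<open>compact E\<close> \<open>convex E\<close>] by auto
  have vertex_facets: "\<exists>G. G \<in> facets P \<and> G \<notin> S \<and> {F \<in> facets P. x \<in> F} = insert G S"
    if "x extreme_point_of E" for x
  proof -
    have x: "x extreme_point_of P" "x \<in> E"
      using that extreme_point_of_face[OF E_face] by auto
    then have sub: "S \<subseteq> {F \<in> facets P. x \<in> F}"
      using S(1) by (auto simp: E_def)
    have "card ({F \<in> facets P. x \<in> F} - S) = 1"
      using card_Diff_subset[OF finS sub] vert[OF x(1)] S(2) n by simp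
    then obtain G where "{F \<in> facets P. x \<in> F} - S = {G}"
      by (auto simp: card_1_singleton_iff)
    then show ?thesis
      using sub by blast
  qed
  have wP: "w extreme_point_of P" "w \<in> E"
    using \<open>w extreme_point_of E\<close> extreme_point_of_face[OF E_face] by auto
  then have "w \<in> P" "w \<in> Z"
    by (auto simp: E_Z)
  obtain G where G: "G \<in> facets P" "G \<notin> S" "{F \<in> facets P. w \<in> F} = insert G S"
    using vertex_facets[OF \<open>w extreme_point_of E\<close>] by blast

  have "{x. \<forall>F\<in>S. a F \<bullet> x = b F} = (\<Inter>F\<in>S. {x. a F \<bullet> x = b F})"
    by auto
  then have "affine Z"
    unfolding Z_def by (auto intro!: affine_Int affine_Inter affine_hyperplane)
  \<comment> \<open>The n - 1 hyperplanes of \<open>S\<close> leave dimension at least 1; the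
    hyperplane of \<open>G\<close> then cuts \<open>Z\<close> down to a point, so the dimension is
    exactly 1.\<close>
  have "aff_dim Z \<ge> int n - int (n - 1)"
    unfolding Z_def dimP[symmetric] S(2)[symmetric] aff_dim_affine_hull[of P, symmetric]
    using \<open>w \<in> Z\<close> by (intro aff_dim_Int_hyperplanes[OF finS affine_affine_hull]) (auto simp: Z_def)
  then have "aff_dim Z \<ge> 1"
    using n by simp
  have "Z \<inter> {x. a G \<bullet> x = b G} = {w}"
  proof
    show "{w} \<subseteq> Z \<inter> {x. a G \<bullet> x = b G}"
      using \<open>w \<in> Z\<close> G(1,3) mem_iff[OF G(1), of w] by auto
    show "Z \<inter> {x. a G \<bullet> x = b G} \<subseteq> {w}"
    proof
      fix y assume "y \<in> Z \<inter> {x. a G \<bullet> x = b G}"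
      then have "y \<in> affine hull P" "\<And>F. F \<in> insert G S \<Longrightarrow> a F \<bullet> y = b F"
        by (auto simp: Z_def)
      then have "y = w"
        using uniq[OF wP(1), of y] unfolding G(3)[symmetric] by blast
      then show "y \<in> {w}" by simp
    qed
  qed
  then have "aff_dim Z \<le> 1"
    using aff_dim_affine_Int_hyperplane[OF \<open>affine Z\<close>, of "a G" "b G"] aff_dim_sing[of w]
    by (auto split: if_splits)
  then have "aff_dim E \<le> 1"
    using aff_dim_subset[of E Z] by (auto simp: E_Z)
  then have "collinear E"
    by (simp add: collinear_aff_dim)
  then obtain p q where pq: "E = closed_segment p q"
    using compact_convex_collinear_segment[of E] \<open>compact E\<close> \<open>convex E\<close> \<open>x0 \<in> E\<close> by blast

  have "E \<noteq> {w}"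
  proof -
    obtain x where x: "x \<in> Z" "x \<noteq> w"
      using \<open>aff_dim Z \<ge> 1\<close> \<open>w \<in> Z\<close> by (metis aff_dim_sing not_one_le_zero subsetI subset_singletonD singletonI empty_iff insertI1 insertCI)
    \<comment> \<open>The sign keeps \<open>u\<close> in the half-space of \<open>G\<close>, the
      only facet at \<open>w\<close> outside \<open>S\<close>; along the hyperplanes of
      \<open>S\<close> the direction is parallel.\<close>
    define u where "u = (if a G \<bullet> (x - w) \<le> 0 then x - w else w - x)"
    have u_aff: "w + u \<in> affine hull P"
      using x(1) reflect[OF \<open>w \<in> P\<close>, of "x - w"] by (auto simp: u_def Z_def algebra_simps)
    have u_S: "a F \<bullet> u = 0" if "F \<in> S" for F
      using that x(1) \<open>w \<in> Z\<close> by (auto simp: u_def Z_def inner_diff_right)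
    have "a F \<bullet> u \<le> 0" if "F \<in> facets P" "w \<in> F" for F
    proof -
      have "F = G \<or> F \<in> S"
        using G(3) that by auto
      then show ?thesis
        using u_S by (auto simp: u_def inner_diff_right)
    qed
    then obtain e where e: "e > 0" "w + e *\<^sub>R u \<in> P"
      using local_P[OF \<open>w \<in> P\<close> u_aff] by blast
    have "w + e *\<^sub>R u \<in> E"
      unfolding E_Z using e(2) \<open>w \<in> Z\<close> u_S hull_inc[OF e(2), of affine]
      by (auto simp: Z_def inner_add_right)
    moreover have "w + e *\<^sub>R u \<noteq> w"
      using e(1) x(2) by (auto simp: u_def)
    ultimately show ?thesis
      by auto
  qed
  have ext_iff: "x extreme_point_of E \<longleftrightarrow> x = p \<or> x = q" for x
    by (simp add: pq extreme_point_of_segment)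
  have "p \<noteq> q"
  proof
    assume "p = q"
    then have "E = {p}"
      using pq by simp
    moreover have "w = p"
      using \<open>w extreme_point_of E\<close> ext_iff \<open>p = q\<close> by blast
    ultimately show False
      using \<open>E \<noteq> {w}\<close> by simp
  qed
  obtain Gp where Gp: "Gp \<in> facets P" "Gp \<notin> S" "{F \<in> facets P. p \<in> F} = insert Gp S"
    using vertex_facets[of p] ext_iff by blast
  obtain Gq where Gq: "Gq \<in> facets P" "Gq \<notin> S" "{F \<in> facets P. q \<in> F} = insert Gq S"
    using vertex_facets[of q] ext_iff by blast
  have pE: "p extreme_point_of P" "p \<in> E" and qE: "q extreme_point_of P" "q \<in> E"
    using ext_iff extreme_point_of_face[OF E_face] by blast+
  have "Gp \<noteq> Gq"
  proof
    assume "Gp = Gq"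
    then have "\<And>F. F \<in> facets P \<Longrightarrow> p \<in> F \<Longrightarrow> q \<in> F"
      using Gp Gq by blast
    then have "q = p"
      using qE(2) by (intro uniq[OF pE(1)]) (auto simp: E_def mem_iff hull_inc)
    then show False
      using \<open>p \<noteq> q\<close> by simp
  qed
  moreover have "{G \<in> facets P. G \<notin> S \<and> (\<exists>x\<in>P. \<forall>F\<in>insert G S. x \<in> F)} = {Gp, Gq}"
  proof (intro subset_antisym subsetI)
    fix K assume "K \<in> {G \<in> facets P. G \<notin> S \<and> (\<exists>x\<in>P. \<forall>F\<in>insert G S. x \<in> F)}"
    then obtain y where K: "K \<in> facets P" "K \<notin> S" and y: "y \<in> E \<inter> K"
      by (auto simp: E_def)
    have K_face: "K face_of P"
      using K(1) by (simp add: facets_def facet_of_def)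
    \<comment> \<open>A facet that meets \<open>E\<close> contains one of its ends: an extreme point
      of the face of \<open>P\<close> formed by \<open>E\<close> and \<open>K\<close> is extreme in
      \<open>E\<close> as well.\<close>
    have EK: "E \<inter> K face_of P"
      using E_face K_face by (rule face_of_Int)
    then have "compact (E \<inter> K)" "convex (E \<inter> K)"
      using pol face_of_imp_compact face_of_imp_convex polytope_imp_compact polytope_imp_convex
      by blast+
    then obtain z where "z extreme_point_of (E \<inter> K)"
      using extreme_point_exists_convex y by blast
    then have "z extreme_point_of E" "z \<in> K"
      using extreme_point_of_face[OF EK] extreme_point_of_face[OF E_face] by auto
    then have "z = p \<or> z = q" "K \<in> {F \<in> facets P. z \<in> F}"
      using ext_iff K(1) by auto
    then have "K \<in> insert Gp S \<or> K \<in> insert Gq S"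
      using Gp(3) Gq(3) by metis
    then show "K \<in> {Gp, Gq}"
      using K(2) by simp
  next
    fix K assume "K \<in> {Gp, Gq}"
    then have "\<exists>x. x \<in> E \<and> {F \<in> facets P. x \<in> F} = insert K S" and K: "K \<in> facets P" "K \<notin> S"
      using Gp Gq pE(2) qE(2) by auto
    then obtain x where x: "x \<in> E" "{F \<in> facets P. x \<in> F} = insert K S"
      by blast
    then have "x \<in> P" "\<forall>F\<in>insert K S. x \<in> F"
      unfolding x(2)[symmetric] by (auto simp: E_def)
    then show "K \<in> {G \<in> facets P. G \<notin> S \<and> (\<exists>x\<in>P. \<forall>F\<in>insert G S. x \<in> F)}"
      using K by (intro CollectI conjI bexI[of _ x])
  qed
  ultimately show ?thesis
    by simp
qed

section \<open>The polynomial ring\<close>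

lemma carrier_polynomial_ring:
  "p \<in> carrier (polynomial_ring S) \<longleftrightarrow> (\<forall>m\<in>Poly_Mapping.keys p. Poly_Mapping.keys m \<subseteq> S)"
  by (simp add: polynomial_ring_def)

lemma polynomial_ring_simps [simp]:
  "x \<otimes>\<^bsub>polynomial_ring S\<^esub> y = x * y" "x \<oplus>\<^bsub>polynomial_ring S\<^esub> y = x + y"
  "\<one>\<^bsub>polynomial_ring S\<^esub> = 1" "\<zero>\<^bsub>polynomial_ring S\<^esub> = 0"
  by (simp_all add: polynomial_ring_def)

lemma polynomial_ring_closed:
  shows polynomial_ring_zero: "0 \<in> carrier (polynomial_ring S)"
    and polynomial_ring_one: "1 \<in> carrier (polynomial_ring S)"
    and polynomial_ring_add: "\<And>p q. p \<in> carrier (polynomial_ring S) \<Longrightarrow> q \<in> carrier (polynomial_ring S)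
      \<Longrightarrow> p + q \<in> carrier (polynomial_ring S)"
    and polynomial_ring_mult: "\<And>p q. p \<in> carrier (polynomial_ring S) \<Longrightarrow> q \<in> carrier (polynomial_ring S)
      \<Longrightarrow> p * q \<in> carrier (polynomial_ring S)"
    and polynomial_ring_var: "\<And>x. x \<in> S \<Longrightarrow> poly_var x \<in> carrier (polynomial_ring S)"
proof -
  fix p q assume p: "p \<in> carrier (polynomial_ring S)" and q: "q \<in> carrier (polynomial_ring S)"
  show "p + q \<in> carrier (polynomial_ring S)"
    using p q keys_add[of p q] by (auto simp: carrier_polynomial_ring)
  show "p * q \<in> carrier (polynomial_ring S)"
    unfolding carrier_polynomial_ring
  proof
    fix m assume "m \<in> Poly_Mapping.keys (p * q)"
    then obtain a b where "m = a + b" "a \<in> Poly_Mapping.keys p" "b \<in> Poly_Mapping.keys q"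
      using keys_mult[of p q] by blast
    then show "Poly_Mapping.keys m \<subseteq> S"
      using p q keys_add[of a b] by (fastforce simp: carrier_polynomial_ring)
  qed
qed (auto simp: carrier_polynomial_ring poly_var_def)

lemma bit_poly_add_self [simp]: "p + p = 0" for p :: "'v bit_poly"
proof (rule poly_mapping_eqI)
  fix m
  have "x + x = 0" for x :: bit
    by (cases x) simp_all
  then show "Poly_Mapping.lookup (p + p) m = Poly_Mapping.lookup 0 m"
    by (simp only: lookup_add lookup_zero)
qed

lemma cring_polynomial_ring: "cring (polynomial_ring S)"
proof (rule cringI)
  show "abelian_group (polynomial_ring S)"
    by (rule abelian_groupI)
       (auto simp: polynomial_ring_closed add_ac intro: bit_poly_add_self)
  show "comm_monoid (polynomial_ring S)"
    by (rule comm_monoidI) (auto simp: polynomial_ring_closed mult_ac)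
qed (auto simp: distrib_right)

lemma bit_poly_expansion: "p = (\<Sum>m\<in>Poly_Mapping.keys p. Poly_Mapping.single m (Poly_Mapping.lookup p m))"
  by (rule poly_mapping_eqI)
     (auto simp: lookup_sum lookup_single when_def in_keys_iff)


section \<open>Commuting operators that realize the quotient ring\<close>

text \<open>In the quotient ring the variable of a facet \<open>F\<close> of colour \<open>i\<close> satisfies
  \<open>v\<^sub>F\<^sup>2 = v\<^sub>F (u\<^sub>1 + \<dots> + u\<^sub>i\<^sub>-\<^sub>1)\<close>, so the squarefree monomials span.  The operator
  \<open>colour_op F\<close> below is the transpose of the multiplication by \<open>v\<^sub>F\<close> on this span, and
  \<open>lower_sum j\<close> that of the multiplication by \<open>u\<^sub>1 + \<dots> + u\<^sub>j\<close>.\<close>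

locale colour_operators =
  fixes n :: nat and h :: "'v \<Rightarrow> nat" and H :: "nat \<Rightarrow> 'v"
  assumes h_le: "h F \<le> n"
    and h_H: "1 \<le> i \<Longrightarrow> i \<le> n \<Longrightarrow> h (H i) = i"
begin

primrec lower_sum :: "nat \<Rightarrow> ('v set \<Rightarrow> 'k::comm_semiring_1) \<Rightarrow> 'v set \<Rightarrow> 'k" where
  "lower_sum 0 l s = 0"
| "lower_sum (Suc j) l s =
     lower_sum j l s + (if H (Suc j) \<in> s then lower_sum j l s else l (insert (H (Suc j)) s))"

definition colour_op :: "'v \<Rightarrow> ('v set \<Rightarrow> 'k::comm_semiring_1) \<Rightarrow> 'v set \<Rightarrow> 'k" where
  "colour_op F l s = (if F \<in> s then lower_sum (h F - 1) l s else l (insert F s))"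

text \<open>The recursion of \<open>lower_sum\<close> inlines \<open>colour_op (H (Suc j))\<close>,
  which avoids a mutual recursion of the two operators; the intended sum is recovered here, up to n
  because the colour of \<open>H k\<close> is known only there.\<close>

lemma lower_sum_eq_sum:
  "j \<le> n \<Longrightarrow> lower_sum j l s = (\<Sum>k=1..j. colour_op (H k) l s)"
proof (induction j)
  case (Suc j)
  then show ?case
    using h_H[of "Suc j"] by (auto simp: colour_op_def)
qed simp

lemma lower_sum_eq_0:
  "(\<And>k. 1 \<le> k \<Longrightarrow> k \<le> j \<Longrightarrow> H k \<notin> s \<Longrightarrow> l (insert (H k) s) = 0) \<Longrightarrow> lower_sum j l s = 0"
  by (induction j) auto

lemma lower_sum_sum: "lower_sum j (\<lambda>s. \<Sum>k\<in>A. l k s) s = (\<Sum>k\<in>A. lower_sum j (l k) s)"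
  by (induction j) (auto simp: sum.distrib)

lemma colour_op_sum: "colour_op F (\<lambda>s. \<Sum>k\<in>A. l k s) s = (\<Sum>k\<in>A. colour_op F (l k) s)"
  by (auto simp: colour_op_def lower_sum_sum)

lemma lower_sum_scale: "lower_sum j (\<lambda>s. c * l s) s = c * lower_sum j l s"
  by (induction j) (simp_all add: distrib_left)

lemma colour_op_scale: "colour_op F (\<lambda>s. c * l s) = (\<lambda>s. c * colour_op F l s)"
  by (rule ext) (simp add: colour_op_def lower_sum_scale)

text \<open>Induction on the sum of the two colours. If \<open>K\<close> already lies in
  \<open>s\<close>, then \<open>colour_op K\<close> is at \<open>s\<close> a sum of operators of
  variables \<open>H k\<close> of strictly smaller colour; if not, it merely inserts
  \<open>K\<close>, and insertions commute.\<close>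

lemma colour_op_commute:
  fixes l :: "'v set \<Rightarrow> 'k::comm_semiring_1"
  shows "colour_op F (colour_op G l) s = colour_op G (colour_op F l) s"
proof (induction "h F + h G" arbitrary: F G l s rule: less_induct)
  case less
  have H_less: "h (H k) < h K" if "k \<in> {1..h K - 1}" for k K
    using that h_H[of k] h_le[of K] by auto
  have expand: "colour_op K l s = (\<Sum>k=1..h K - 1. colour_op (H k) l s)" if "K \<in> s"
    for K s and l :: "'v set \<Rightarrow> 'k"
  proof -
    have "h K - 1 \<le> n"
      using h_le[of K] by simp
    then show ?thesis
      using that by (simp only: colour_op_def[of K] if_True lower_sum_eq_sum)
  qed
  have one: "colour_op K (colour_op L l) s = colour_op L (colour_op K l) s"
    if K: "K \<in> s" and L: "L \<notin> s" and KL: "h K + h L = h F + h G" for K L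
  proof -
    have "colour_op K (colour_op L l) s = (\<Sum>k=1..h K - 1. colour_op (H k) (colour_op L l) s)"
      by (rule expand[OF K])
    also have "\<dots> = (\<Sum>k=1..h K - 1. colour_op L (colour_op (H k) l) s)"
      using H_less KL by (intro sum.cong less refl) fastforce
    also have "\<dots> = (\<Sum>k=1..h K - 1. colour_op (H k) l (insert L s))"
      using L by (simp add: colour_op_def[of L])
    also have "\<dots> = colour_op K l (insert L s)"
      using K by (simp add: expand)
    also have "\<dots> = colour_op L (colour_op K l) s"
      using L by (simp add: colour_op_def[of L])
    finally show ?thesis .
  qed
  consider "F \<in> s" "G \<in> s" | "F \<in> s" "G \<notin> s" | "F \<notin> s" "G \<in> s" | "F \<notin> s" "G \<notin> s" by blast
  then show ?case
  proof cases
    case 1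
    \<comment> \<open>Expanding both operators leaves double sums that differ only in the order of
      operators of smaller colours.\<close>
    have two: "colour_op K (colour_op L l) s =
        (\<Sum>k=1..h K - 1. \<Sum>j=1..h L - 1. colour_op (H j) (colour_op (H k) l) s)"
      if "K \<in> s" "L \<in> s" "h K + h L = h F + h G" for K L
    proof -
      have "colour_op K (colour_op L l) s = (\<Sum>k=1..h K - 1. colour_op (H k) (colour_op L l) s)"
        by (rule expand) fact
      also have "\<dots> = (\<Sum>k=1..h K - 1. colour_op L (colour_op (H k) l) s)"
        using H_less that by (intro sum.cong less refl) fastforce
      finally show ?thesis
        using \<open>L \<in> s\<close> by (simp add: expand)
    qed
    have "colour_op F (colour_op G l) s =
        (\<Sum>j=1..h G - 1. \<Sum>k=1..h F - 1. colour_op (H j) (colour_op (H k) l) s)"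
      by (subst sum.swap) (rule two[OF 1 refl])
    also have "\<dots> = (\<Sum>j=1..h G - 1. \<Sum>k=1..h F - 1. colour_op (H k) (colour_op (H j) l) s)"
      using H_less by (intro sum.cong less refl) (metis add.commute add_strict_mono)
    also have "\<dots> = colour_op G (colour_op F l) s"
      by (rule two[OF 1(2,1) add.commute, symmetric])
    finally show ?thesis .
  next
    case 2
    then show ?thesis by (intro one) auto
  next
    case 3
    then show ?thesis by (intro one[symmetric]) auto
  next
    case 4
    then show ?thesis by (auto simp: colour_op_def insert_commute)
  qed
qed

text \<open>A monomial is the multiset of its variables, and commutation makes folding the operators
  over a multiset independent of the order.\<close>

sublocale comp_fun_commute colour_op
  by unfold_locales (auto simp: colour_op_commute fun_eq_iff)

definition monomial_act :: "('v \<Rightarrow>\<^sub>0 nat) \<Rightarrow> ('v set \<Rightarrow> 'k::comm_semiring_1) \<Rightarrow> 'v set \<Rightarrow> 'k" where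
  "monomial_act m l = fold_mset colour_op l (Abs_multiset (Poly_Mapping.lookup m))"

definition poly_act :: "'v bit_poly \<Rightarrow> ('v set \<Rightarrow> bit) \<Rightarrow> 'v set \<Rightarrow> bit" where
  "poly_act p l s = (\<Sum>m\<in>Poly_Mapping.keys p. Poly_Mapping.lookup p m * monomial_act m l s)"

lemma count_Abs_multiset_lookup: "count (Abs_multiset (Poly_Mapping.lookup m)) F = Poly_Mapping.lookup m F"
  using finite_lookup[of m] by (simp add: count_Abs_multiset)

lemma monomial_act_zero: "monomial_act 0 l = l"
proof -
  have "Abs_multiset (Poly_Mapping.lookup (0 :: 'v \<Rightarrow>\<^sub>0 nat)) = {#}"
    by (rule multiset_eqI) (simp add: count_Abs_multiset_lookup)
  then show ?thesis
    by (simp add: monomial_act_def)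
qed

lemma monomial_act_add: "monomial_act (m + m') l = monomial_act m (monomial_act m' l)"
proof -
  have "Abs_multiset (Poly_Mapping.lookup (m + m')) =
      Abs_multiset (Poly_Mapping.lookup m') + Abs_multiset (Poly_Mapping.lookup m)"
    by (rule multiset_eqI) (simp add: count_Abs_multiset_lookup lookup_add)
  then show ?thesis
    by (simp add: monomial_act_def)
qed

lemma monomial_act_single: "monomial_act (Poly_Mapping.single F 1) l = colour_op F l"
proof -
  have "Abs_multiset (Poly_Mapping.lookup (Poly_Mapping.single F (1::nat))) = {#F#}"
    by (rule multiset_eqI) (simp add: count_Abs_multiset_lookup lookup_single when_def)
  then show ?thesis
    by (simp add: monomial_act_def)
qed

lemma monomial_act_sum: "monomial_act m (\<lambda>s. \<Sum>k\<in>A. l k s) = (\<lambda>s. \<Sum>k\<in>A. monomial_act m (l k) s)"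
proof -
  have "fold_mset colour_op (\<lambda>s. \<Sum>k\<in>A. l k s) M = (\<lambda>s. \<Sum>k\<in>A. fold_mset colour_op (l k) M s)" for M
    by (induction M) (auto simp: colour_op_sum)
  then show ?thesis
    by (simp add: monomial_act_def)
qed

lemma monomial_act_scale: "monomial_act m (\<lambda>s. c * l s) = (\<lambda>s. c * monomial_act m l s)"
proof -
  have "fold_mset colour_op (\<lambda>s. c * l s) M = (\<lambda>s. c * fold_mset colour_op l M s)" for M
    by (induction M) (simp_all add: colour_op_scale)
  then show ?thesis
    by (simp add: monomial_act_def)
qed

lemma poly_act_superset:
  assumes "finite A" "Poly_Mapping.keys p \<subseteq> A"
  shows "poly_act p l s = (\<Sum>m\<in>A. Poly_Mapping.lookup p m * monomial_act m l s)"
  unfolding poly_act_def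
  by (rule sum.mono_neutral_left) (use assms in \<open>auto simp: in_keys_iff\<close>)

lemma poly_act_zero: "poly_act 0 l s = 0"
  by (simp add: poly_act_def)

lemma poly_act_add: "poly_act (p + q) l s = poly_act p l s + poly_act q l s"
proof -
  let ?A = "Poly_Mapping.keys p \<union> Poly_Mapping.keys q"
  have "poly_act r l s = (\<Sum>m\<in>?A. Poly_Mapping.lookup r m * monomial_act m l s)" if "r \<in> {p, q, p + q}" for r
    using that keys_add[of p q] by (intro poly_act_superset) auto
  then show ?thesis
    by (simp only: insert_iff simp_thms lookup_add distrib_right sum.distrib)
qed

lemma poly_act_sum: "poly_act (\<Sum>i\<in>A. p i) l s = (\<Sum>i\<in>A. poly_act (p i) l s)"
  by (induction A rule: infinite_finite_induct) (simp_all only: poly_act_zero poly_act_add sum.insert sum.infinite sum.empty not_False_eq_True)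

lemma poly_act_single: "poly_act (Poly_Mapping.single m c) l s = c * monomial_act m l s"
  by (subst poly_act_superset[of "{m}"]) simp_all

text \<open>Products become compositions because exponents add as multisets and the operators are
  linear. So the annihilator of a function is closed under multiplication by any polynomial.\<close>

lemma poly_act_mult: "poly_act (p * q) l s = poly_act p (poly_act q l) s"
proof -
  have "p * q = (\<Sum>m\<in>Poly_Mapping.keys p. \<Sum>m'\<in>Poly_Mapping.keys q.
      Poly_Mapping.single (m + m') (Poly_Mapping.lookup p m * Poly_Mapping.lookup q m'))"
    by (subst bit_poly_expansion[of p], subst bit_poly_expansion[of q])
       (simp only: sum_product mult_single)
  then have "poly_act (p * q) l s = (\<Sum>m\<in>Poly_Mapping.keys p. \<Sum>m'\<in>Poly_Mapping.keys q.
      Poly_Mapping.lookup p m * Poly_Mapping.lookup q m' * monomial_act (m + m') l s)"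
    by (simp only: poly_act_sum poly_act_single)
  also have "\<dots> = (\<Sum>m\<in>Poly_Mapping.keys p. Poly_Mapping.lookup p m * monomial_act m (poly_act q l) s)"
    by (simp only: poly_act_def[abs_def] monomial_act_sum monomial_act_scale monomial_act_add
        sum_distrib_left mult.assoc)
  finally show ?thesis
    by (simp only: poly_act_def)
qed

lemma poly_act_var: "poly_act (poly_var F) l s = colour_op F l s"
  by (simp only: poly_var_def poly_act_single monomial_act_single mult_1)

lemma poly_act_one: "poly_act 1 l s = l s"
  using poly_act_single[of 0 1 l s] by (simp only: single_one monomial_act_zero mult_1)

lemma poly_act_zero_right: "poly_act p (\<lambda>_. 0) = (\<lambda>_. 0)"
proof -
  have "monomial_act m (\<lambda>_. 0) s = (0 :: bit)" for m s
    using fun_cong[OF monomial_act_scale[of m 0 "\<lambda>_. 0"], of s] by (simp only: mult_zero_left)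
  then show ?thesis
    by (intro ext) (simp only: poly_act_def mult_zero_right sum.neutral_const)
qed

text \<open>Only the inserting branch of \<open>colour_op\<close> is reached as long as every new
  variable lies outside the current set.\<close>

lemma poly_act_prod_var_disjoint:
  "finite S \<Longrightarrow> S \<inter> s = {} \<Longrightarrow> poly_act (\<Prod>F\<in>S. poly_var F) l s = l (S \<union> s)"
proof (induction S arbitrary: s rule: finite_induct)
  case empty
  then show ?case by (simp add: poly_act_one)
next
  case (insert F S)
  have "poly_act (\<Prod>F\<in>insert F S. poly_var F) l s = colour_op F (poly_act (\<Prod>F\<in>S. poly_var F) l) s"
    using insert.hyps by (simp only: prod.insert not_False_eq_True poly_act_mult poly_act_var)
  also have "\<dots> = poly_act (\<Prod>F\<in>S. poly_var F) l (insert F s)"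
    using insert.prems by (simp add: colour_op_def)
  also have "\<dots> = l (S \<union> insert F s)"
    using insert by (intro insert.IH) auto
  finally show ?case by simp
qed

text \<open>No branch of \<open>colour_op\<close> removes a variable, so \<open>l\<close> is
  evaluated at supersets of \<open>S\<close> only. Meant for sets of facets without a common
  point.\<close>

lemma poly_act_prod_var_eq_0:
  "finite S \<Longrightarrow> (\<And>t. S \<subseteq> t \<Longrightarrow> l t = 0) \<Longrightarrow> poly_act (\<Prod>F\<in>S. poly_var F) l s = 0"
proof (induction S arbitrary: s l rule: finite_induct)
  case empty
  then show ?case by (simp only: prod.empty poly_act_one empty_subsetI)
next
  case (insert F S)
  have "poly_act (\<Prod>F\<in>insert F S. poly_var F) l s = poly_act (\<Prod>F\<in>S. poly_var F) (colour_op F l) s"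
    using insert.hyps by (simp only: prod.insert not_False_eq_True mult.commute[of "poly_var F"] poly_act_mult poly_act_var[abs_def])
  also have "\<dots> = 0"
  proof (rule insert.IH)
    fix t assume t: "S \<subseteq> t"
    have "l t' = 0" if "F \<in> t'" "S \<subseteq> t'" for t'
      using insert.prems that by simp
    then show "colour_op F l t = 0"
      unfolding colour_op_def using t by (auto intro!: lower_sum_eq_0)
  qed
  finally show ?case .
qed

lemma poly_act_lower_sum:
  "i \<le> n \<Longrightarrow> poly_act (\<Sum>j=1..i. poly_var (H j)) l s = lower_sum i l s"
  by (simp only: poly_act_sum poly_act_var lower_sum_eq_sum)

end

section \<open>The monomial of the base vertex is not a relation\<close>

lemma generators_in_carrier:
  assumes V: "base_vertex n P h V H"
  shows "nonface_monomials P \<union> linear_forms n P h H \<subseteq> carrier (polynomial_ring (facets P))"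
proof -
  let ?Q = "polynomial_ring (facets P)"
  have sums: "(\<Sum>x\<in>A. f x) \<in> carrier ?Q" if "\<And>x. x \<in> A \<Longrightarrow> f x \<in> carrier ?Q" for A and f :: "'x \<Rightarrow> _"
    using that by (induction A rule: infinite_finite_induct) (auto simp: polynomial_ring_closed)
  have prods: "(\<Prod>x\<in>A. f x) \<in> carrier ?Q" if "\<And>x. x \<in> A \<Longrightarrow> f x \<in> carrier ?Q" for A and f :: "'x \<Rightarrow> _"
    using that by (induction A rule: infinite_finite_induct) (auto simp: polynomial_ring_closed)
  have H: "poly_var (H j) \<in> carrier ?Q" if "1 \<le> j" "j \<le> n" for j
    using V that by (auto simp: base_vertex_def polynomial_ring_var)
  have "p \<in> carrier ?Q" if "p \<in> nonface_monomials P" for p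
    using that by (auto simp: nonface_monomials_def subset_eq polynomial_ring_var intro!: prods)
  moreover have "p \<in> carrier ?Q" if "p \<in> linear_forms n P h H" for p
    using that by (auto simp: linear_forms_def polynomial_ring_var H intro!: polynomial_ring_add sums)
  ultimately show ?thesis
    by blast
qed

lemma base_vertex_bij:
  assumes V: "base_vertex n P h V H"
  shows "inj_on H {1..n}" "H ` {1..n} \<subseteq> facets P" "\<And>i. 1 \<le> i \<Longrightarrow> i \<le> n \<Longrightarrow> h (H i) = i"
proof -
  show hH: "h (H i) = i" if "1 \<le> i" "i \<le> n" for i
    using V that by (simp add: base_vertex_def)
  show "inj_on H {1..n}"
    by (rule inj_on_inverseI[of _ h]) (simp add: hH)
  show "H ` {1..n} \<subseteq> facets P"
    using V by (auto simp: base_vertex_def)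
qed

text \<open>The polynomials whose action annihilates the counting function \<open>l0\<close> form an
  ideal that contains all generators, whereas the vertex monomial turns \<open>l0\<close> into a
  function with value 1 at the empty set.\<close>

proposition vertex_monomial_not_in_ideal:
  fixes P :: "'a::euclidean_space set"
  assumes P: "simple_polytope n P" and n: "n \<ge> 1" and h: "proper_coloring n P h"
    and V: "base_vertex n P h V H"
  shows "(\<Prod>i=1..n. poly_var (H i)) \<notin>
    Idl\<^bsub>polynomial_ring (facets P)\<^esub> (nonface_monomials P \<union> linear_forms n P h H)"
proof -
  let ?Q = "polynomial_ring (facets P)"
  interpret Q: cring ?Q
    by (rule cring_polynomial_ring)
  \<comment> \<open>The operators exist for every set, facet or not; the default colour 0 respects
    the bound \<open>h_le\<close>.\<close>
  define c where "c F = (if F \<in> facets P then h F else 0)" for F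
  note H = base_vertex_bij[OF V]
  have Hf: "H i \<in> facets P" if "1 \<le> i" "i \<le> n" for i
    using H(2) that by auto
  interpret colour_operators n c H
  proof
    show "c F \<le> n" for F
      using h by (auto simp: c_def proper_coloring_def)
    show "1 \<le> i \<Longrightarrow> i \<le> n \<Longrightarrow> c (H i) = i" for i
      using H(3) Hf by (simp add: c_def)
  qed
  have fin: "finite (facets P)"
    using P by (simp add: simple_polytope_def finite_facets)

  define face where "face s \<longleftrightarrow> s \<subseteq> facets P \<and> (\<exists>x\<in>P. \<forall>F\<in>s. x \<in> F)" for s
  define l0 :: "'a set set \<Rightarrow> bit" where "l0 s = of_bool (face s \<and> card s = n)" for s
  have face_subset: "face s" if "face t" "s \<subseteq> t" for s t
    using that unfolding face_def by blast
  have colour_unique: "F = G" if "face s" "F \<in> s" "G \<in> s" "h F = h G" for s F G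
  proof (rule ccontr)
    assume "F \<noteq> G"
    moreover have "F \<in> facets P" "G \<in> facets P" "F \<inter> G \<noteq> {}"
      using that by (auto simp: face_def)
    ultimately show False
      using h that(4) by (auto simp: proper_coloring_def)
  qed

  have nonface: "poly_act p l0 s = 0" if p: "p \<in> nonface_monomials P" for p s
  proof -
    obtain S where S: "p = (\<Prod>F\<in>S. poly_var F)" "S \<subseteq> facets P" "\<Inter>S = {}"
      using p by (auto simp: nonface_monomials_def)
    have "l0 t = 0" if "S \<subseteq> t" for t
      using S(3) that by (auto simp: l0_def face_def)
    moreover have "finite S"
      using S(2) fin finite_subset by blast
    ultimately show ?thesis
      unfolding S(1) by (intro poly_act_prod_var_eq_0)
  qed

  have linear: "poly_act p l0 s = 0" if p: "p \<in> linear_forms n P h H" for p s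
  proof -
    define C where "C i = {F \<in> facets P. h F = i}" for i
    obtain i where i: "1 \<le> i" "i \<le> n"
      and p_eq: "p = (\<Sum>j=1..i. poly_var (H j)) + (\<Sum>F\<in>C i - {H i}. poly_var F)"
      using p by (auto simp: linear_forms_def C_def)
    have HC: "H i \<in> C i"
      using H(3) Hf i by (simp add: C_def)
    have finC: "finite (C i)"
      using fin by (simp add: C_def)
    \<comment> \<open>Splitting off \<open>H i\<close> completes the second sum to the whole colour
      class and leaves the lower sum of index i - 1, the one that \<open>colour_op\<close> uses for
      colour i.\<close>
    have "(\<Sum>j=1..i. poly_var (H j)) = (\<Sum>j=1..i - 1. poly_var (H j)) + poly_var (H i)"
      using i(1) by (cases i) simp_all
    then have "p = (\<Sum>j=1..i - 1. poly_var (H j)) + (\<Sum>F\<in>C i. poly_var F)"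
      using HC finC by (simp add: p_eq sum.remove[of "C i" "H i"] add.assoc)
    then have act_p: "poly_act p l0 s = lower_sum (i - 1) l0 s + (\<Sum>F\<in>C i. colour_op F l0 s)"
      using i(2) by (simp only: poly_act_add poly_act_sum poly_act_var) (simp only: poly_act_lower_sum poly_act_sum[symmetric] poly_act_var[symmetric] diff_le_self le_trans)
    \<comment> \<open>If \<open>s\<close> is not a face, nothing containing it counts. If
      \<open>s\<close> has a facet \<open>G\<close> of colour i, then \<open>G\<close> reproduces
      the lower sum, which cancels in characteristic two. The case of a missing colour i is the
      geometric one.\<close>
    consider "\<not> face s" | G where "face s" "G \<in> s" "h G = i" | "face s" "\<And>G. G \<in> s \<Longrightarrow> h G \<noteq> i"
      by blast
    then show ?thesis
    proof cases
      case 1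
      then have "\<not> face (insert F s)" for F
        using face_subset by blast
      then have l0: "l0 (insert F s) = 0" for F
        by (simp add: l0_def)
      then have "lower_sum j l0 s = 0" for j
        by (simp add: lower_sum_eq_0)
      then show ?thesis
        unfolding act_p using l0 by (auto simp: colour_op_def intro!: sum.neutral)
    next
      case 2
      have "colour_op F l0 s = (if F = G then lower_sum (i - 1) l0 s else 0)" if "F \<in> C i" for F
      proof (cases "F = G")
        case True
        then show ?thesis
          using 2 that by (simp add: colour_op_def c_def C_def)
      next
        case False
        then have "\<not> face (insert F s)" "F \<notin> s"
          using colour_unique[of "insert F s" F G] 2 that insert_absorb[of F s] by (auto simp: C_def)
        then show ?thesis
          using False by (simp add: colour_op_def l0_def)
      qed
      moreover have "G \<in> C i"
        using 2 by (auto simp: C_def face_def)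
      ultimately have "(\<Sum>F\<in>C i. colour_op F l0 s) = lower_sum (i - 1) l0 s"
        using finC by simp
      then show ?thesis
        unfolding act_p by (cases "lower_sum (i - 1) l0 s") simp_all
    next
      case 3
      have fin_s: "finite s"
        using 3 fin finite_subset by (auto simp: face_def)
      have op: "colour_op F l0 s = l0 (insert F s)" if "F \<in> C i" for F
        using 3 that by (auto simp: colour_op_def C_def)
      show ?thesis
      proof (cases "card s = n - 1")
        case False
        then have l0: "l0 (insert F s) = 0" if "F \<notin> s" for F
          using that fin_s n by (auto simp: l0_def)
        then have "lower_sum j l0 s = 0" for j
          by (simp add: lower_sum_eq_0)
        then show ?thesis
          unfolding act_p using l0 op 3 by (auto simp: C_def intro!: sum.neutral)
      next
        case True
        \<comment> \<open>These are n - 1 distinct colours different from i, so i is the only one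
          left for a facet that completes \<open>s\<close> to a vertex.\<close>
        have "h ` s = {1..n} - {i}"
        proof (rule card_subset_eq)
          show "h ` s \<subseteq> {1..n} - {i}"
          proof -
            have "h ` s \<subseteq> h ` facets P"
              using 3(1) by (auto simp: face_def)
            then show ?thesis
              using h 3(2) by (auto simp: proper_coloring_def)
          qed
          have "inj_on h s"
            using colour_unique 3(1) by (auto intro!: inj_onI)
          then show "card (h ` s) = card ({1..n} - {i})"
            using True i by (simp add: card_image)
        qed simp
        then have other: "h F = i" if "F \<in> facets P" "F \<notin> s" "face (insert F s)" for F
        proof -
          have "h F \<in> {1..n}"
            using that(1) h by (auto simp: proper_coloring_def)
          moreover have "h F \<notin> h ` s"
            using that colour_unique[of "insert F s" F] by auto
          ultimately show ?thesis
            using \<open>h ` s = _\<close> by auto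
        qed
        have "lower_sum (i - 1) l0 s = 0"
        proof (rule lower_sum_eq_0)
          fix k assume k: "1 \<le> k" "k \<le> i - 1" "H k \<notin> s"
          then have "\<not> face (insert (H k) s)"
            using other[of "H k"] Hf[of k] H(3)[of k] i by auto
          then show "l0 (insert (H k) s) = 0"
            by (simp add: l0_def)
        qed
        moreover have "(\<Sum>F\<in>C i. colour_op F l0 s) = 0"
        proof -
          have "(\<Sum>F\<in>C i. colour_op F l0 s) = (\<Sum>F\<in>C i. of_bool (face (insert F s)))"
          proof (rule sum.cong)
            fix F assume F: "F \<in> C i"
            then have "F \<notin> s"
              using 3 by (auto simp: C_def)
            then have "card (insert F s) = n"
              using fin_s True n by simp
            then show "colour_op F l0 s = of_bool (face (insert F s))"
              by (simp add: op[OF F] l0_def)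
          qed simp
          also have "\<dots> = of_nat (card {F \<in> C i. face (insert F s)})"
            using finC by (simp add: Int_def sum_of_bool_eq)
          also have "{F \<in> C i. face (insert F s)} =
              {G \<in> facets P. G \<notin> s \<and> (\<exists>x\<in>P. \<forall>F\<in>insert G s. x \<in> F)}"
            using other 3 by (fastforce simp: C_def face_def)
          \<comment> \<open>The completions of \<open>s\<close> correspond to the two ends of the
            edge cut out by \<open>s\<close>, and 2 is zero in \<open>bit\<close>.\<close>
          also have "card \<dots> = 2"
          proof -
            obtain x where "s \<subseteq> facets P" "x \<in> P" "\<And>F. F \<in> s \<Longrightarrow> x \<in> F"
              using 3(1) by (auto simp: face_def)
            then show ?thesis
              by (intro simple_polytope_edge[OF P n _ True])
          qed
          finally show ?thesis by simp
        qed
        ultimately show ?thesis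
          by (simp only: act_p add_0)
      qed
    qed
  qed

  \<comment> \<open>Vanishing is demanded at all \<open>s\<close>, not only at the empty set: by
    \<open>poly_act_mult\<close> this makes \<open>J\<close> stable under multiplication.\<close>
  define J where "J = {p \<in> carrier ?Q. \<forall>s. poly_act p l0 s = 0}"
  have J_mult: "q * p \<in> J" if "p \<in> J" "q \<in> carrier ?Q" for p q
  proof -
    have "poly_act p l0 = (\<lambda>_. 0)"
      using that by (auto simp: J_def)
    then show ?thesis
      using that by (simp add: J_def poly_act_mult poly_act_zero_right polynomial_ring_mult)
  qed
  have "ideal J ?Q"
  proof (rule idealI)
    show "ring ?Q"
      by (rule Q.ring_axioms)
    show "subgroup J (add_monoid ?Q)"
    proof (rule Q.add.subgroupI)
      show "J \<subseteq> carrier ?Q"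
        by (auto simp: J_def)
      show "J \<noteq> {}"
        using polynomial_ring_zero poly_act_zero by (auto simp: J_def)
      show "\<ominus>\<^bsub>?Q\<^esub> p \<in> J" if p: "p \<in> J" for p
      proof -
        have "p \<in> carrier ?Q"
          using p by (simp add: J_def)
        then have "\<ominus>\<^bsub>?Q\<^esub> p = p"
          using Q.minus_equality[of p p] by simp
        then show ?thesis
          using p by simp
      qed
      show "p \<oplus>\<^bsub>?Q\<^esub> q \<in> J" if "p \<in> J" "q \<in> J" for p q
        using that by (simp add: J_def poly_act_add polynomial_ring_add)
    qed
    show "q \<otimes>\<^bsub>?Q\<^esub> p \<in> J" "p \<otimes>\<^bsub>?Q\<^esub> q \<in> J" if "p \<in> J" "q \<in> carrier ?Q" for p q
      using J_mult[OF that] by (simp_all add: mult.commute)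
  qed
  moreover have "nonface_monomials P \<union> linear_forms n P h H \<subseteq> J"
    using nonface linear generators_in_carrier[OF V] by (auto simp: J_def)
  ultimately have "Idl\<^bsub>?Q\<^esub> (nonface_monomials P \<union> linear_forms n P h H) \<subseteq> J"
    by (rule Q.genideal_minimal)
  moreover have "(\<Prod>i=1..n. poly_var (H i)) \<notin> J"
  proof -
    have "V \<in> P" "\<forall>F\<in>H ` {1..n}. V \<in> F"
      using V by (auto simp: base_vertex_def extreme_point_of_def)
    then have "face (H ` {1..n})"
      using H(2) unfolding face_def by blast
    moreover have "(\<Prod>i=1..n. poly_var (H i)) = (\<Prod>F\<in>H ` {1..n}. poly_var F)"
      using H(1) by (simp add: prod.reindex)
    ultimately have "poly_act (\<Prod>i=1..n. poly_var (H i)) l0 {} = 1"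
      using H(1) by (simp add: poly_act_prod_var_disjoint l0_def card_image)
    then show ?thesis
      by (auto simp: J_def)
  qed
  ultimately show ?thesis
    by blast
qed

section \<open>Congruences modulo an ideal in characteristic two\<close>

text \<open>Computations run in the ambient type, where type-class arithmetic applies.
  \<open>C\<close> stands for the polynomials in the facets, and \<open>J\<close> absorbs
  multiplication by elements of \<open>C\<close> only, hence the membership conditions
  throughout.\<close>

locale char2_ideal =
  fixes C J :: "'r::comm_ring_1 set"
  assumes add_self: "\<And>x::'r. x + x = 0"
    and C_1: "1 \<in> C"
    and C_add: "\<And>x y. x \<in> C \<Longrightarrow> y \<in> C \<Longrightarrow> x + y \<in> C"
    and C_mult: "\<And>x y. x \<in> C \<Longrightarrow> y \<in> C \<Longrightarrow> x * y \<in> C"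
    and J_0: "0 \<in> J"
    and J_add: "\<And>x y. x \<in> J \<Longrightarrow> y \<in> J \<Longrightarrow> x + y \<in> J"
    and J_mult: "\<And>x y. x \<in> C \<Longrightarrow> y \<in> J \<Longrightarrow> x * y \<in> J"
begin

definition cong :: "'r \<Rightarrow> 'r \<Rightarrow> bool" where
  "cong x y \<longleftrightarrow> x + y \<in> J"

lemma add_self_left: "x + (x + y) = (y :: 'r)"
  by (simp only: add.assoc[symmetric] add_self add_0_left)

lemmas char2_simps = add_self add_self_left add_0_left add_0_right distrib_left distrib_right
  mult_1_left mult_1_right add.assoc add.commute add.left_commute
  mult.assoc mult.commute mult.left_commute

lemma C_0: "0 \<in> C"
  using C_add[OF C_1 C_1] by (simp only: add_self)

lemma C_power: "x \<in> C \<Longrightarrow> x ^ k \<in> C"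
  by (induction k) (auto simp: C_1 C_mult)

lemma C_prod: "(\<And>i. i \<in> A \<Longrightarrow> f i \<in> C) \<Longrightarrow> prod f A \<in> C"
  by (induction A rule: infinite_finite_induct) (auto simp: C_1 C_mult)

lemma C_sum: "(\<And>i. i \<in> A \<Longrightarrow> f i \<in> C) \<Longrightarrow> sum f A \<in> C"
  by (induction A rule: infinite_finite_induct) (auto simp: C_0 C_add)

lemma J_sum: "(\<And>i. i \<in> A \<Longrightarrow> f i \<in> J) \<Longrightarrow> sum f A \<in> J"
  by (induction A rule: infinite_finite_induct) (auto simp: J_0 J_add)

lemma cong_refl: "cong x x"
  by (simp only: cong_def add_self J_0)

lemma cong_sym: "cong x y \<Longrightarrow> cong y x"
  by (simp only: cong_def add.commute)

lemma cong_trans [trans]: "cong x y \<Longrightarrow> cong y z \<Longrightarrow> cong x z"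
  using J_add[of "x + y" "y + z"] by (simp only: cong_def char2_simps)

lemma cong_0_iff: "cong x 0 \<longleftrightarrow> x \<in> J"
  by (simp add: cong_def)

lemma cong_add: "cong x y \<Longrightarrow> cong x' y' \<Longrightarrow> cong (x + x') (y + y')"
  using J_add[of "x + y" "x' + y'"] by (simp only: cong_def char2_simps)

lemma cong_mult:
  assumes "x \<in> C" "y' \<in> C" "cong x y" "cong x' y'"
  shows "cong (x * x') (y * y')"
proof -
  have "x * (x' + y') + y' * (x + y) \<in> J"
    using assms by (simp add: cong_def J_add J_mult del: distrib_left)
  moreover have "x * (x' + y') + y' * (x + y) = x * x' + y * y'"
    by (simp only: char2_simps)
  ultimately show ?thesis
    by (simp only: cong_def)
qed

lemma cong_mult_left: "x \<in> C \<Longrightarrow> cong y z \<Longrightarrow> cong (x * y) (x * z)"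
  using J_mult[of x "y + z"] by (simp only: cong_def distrib_left)

lemma cong_sum: "(\<And>i. i \<in> A \<Longrightarrow> cong (f i) (g i)) \<Longrightarrow> cong (sum f A) (sum g A)"
  by (induction A rule: infinite_finite_induct) (auto simp: cong_refl intro: cong_add)

lemma cong_prod:
  "(\<And>i. i \<in> A \<Longrightarrow> f i \<in> C \<and> g i \<in> C \<and> cong (f i) (g i)) \<Longrightarrow> cong (prod f A) (prod g A)"
  by (induction A rule: infinite_finite_induct) (auto simp: cong_refl intro!: cong_mult C_prod)

end

text \<open>The recursive definition anticipates the expansion of the inverse of
  \<open>(1 + s\<^sub>1) \<dots> (1 + s\<^sub>m\<^sub>-\<^sub>1)\<close>.  In characteristic two
  \<open>(1 + x)\<^sup>-\<^sup>1 = \<Sum>\<^sub>r (x + x\<^sup>2)\<^bsup>2\<^sup>r - 1\<^esup>\<close>, and \<open>s\<^sub>i\<^sup>2 = s\<^sub>i s\<^sub>i\<^sub>-\<^sub>1\<close> turns the powers of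
  \<open>s\<^sub>i + s\<^sub>i\<^sup>2 = s\<^sub>i (1 + s\<^sub>i\<^sub>-\<^sub>1)\<close> into products that cancel factors of the denominator.\<close>

function ladder_inverse :: "(nat \<Rightarrow> 'r::comm_ring_1) \<Rightarrow> nat \<Rightarrow> 'r" where
  "ladder_inverse s m = (if m = 0 then 1 else
     (\<Sum>r\<in>{r. 2 ^ r \<le> m}. (\<Prod>j<2 ^ r - 1. s (m - 1 - j)) * ladder_inverse s (m - 2 ^ r)))"
  by auto
termination
  by (relation "Wellfounded.measure snd") auto

declare ladder_inverse.simps [simp del]

lemma finite_powers_le: "finite {r::nat. 2 ^ r \<le> (m::nat)}"
proof (rule finite_subset)
  show "{r. 2 ^ r \<le> m} \<subseteq> {..m}"
  proof
    fix r :: nat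
    assume "r \<in> {r. 2 ^ r \<le> m}"
    then show "r \<in> {..m}"
      using order.strict_trans2[OF less_exp[of r], of m] by simp
  qed
qed simp

text \<open>\<open>R\<close> is the number of binary digits of \<open>m\<close>; an initial segment
  of exponents is what the telescoping sum requires.\<close>

lemma powers_le_eq_lessThan:
  obtains R :: nat where "{r. 2 ^ r \<le> (m::nat)} = {..<R}" "m < 2 ^ R"
proof -
  define R where "R = (LEAST r. m < (2::nat) ^ r)"
  have R: "m < 2 ^ R"
    unfolding R_def using less_exp[of m] by (rule LeastI)
  have "2 ^ r \<le> m \<longleftrightarrow> r < R" for r :: nat
  proof
    assume "2 ^ r \<le> m"
    then have "(2::nat) ^ r < 2 ^ R"
      using R by (rule le_less_trans)
    then show "r < R" by simp
  next
    assume "r < R"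
    then show "2 ^ r \<le> m"
      unfolding R_def using not_less_Least by (metis not_less)
  qed
  then show thesis
    using that[of R] R by auto
qed

section \<open>Inverting (1 + s_1) ... (1 + s_(m-1)) modulo the relations s_i^2 = s_i
  s_(i-1)\<close>

locale ladder = char2_ideal C J for C J :: "'r::comm_ring_1 set" +
  fixes s :: "nat \<Rightarrow> 'r" and N :: nat
  assumes s_0: "s 0 = 0"
    and s_C: "\<And>i. i \<le> N \<Longrightarrow> s i \<in> C"
    and s_square: "\<And>i. 1 \<le> i \<Longrightarrow> i \<le> N \<Longrightarrow> s i * s i + s i * s (i - 1) \<in> J"
begin

text \<open>Congruence modulo the ideal quotient of \<open>J\<close> by \<open>s i\<close>. It
  respects sums and products and identifies \<open>s i\<close> with \<open>s (i - 1)\<close>, so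
  next to a factor \<open>s i\<close> a polynomial in one may be replaced by the same polynomial in
  the other.\<close>

definition near :: "nat \<Rightarrow> 'r \<Rightarrow> 'r \<Rightarrow> bool" where
  "near i x y \<longleftrightarrow> x \<in> C \<and> y \<in> C \<and> cong (s i * x) (s i * y)"

lemma near_refl: "x \<in> C \<Longrightarrow> near i x x"
  by (simp add: near_def cong_refl)

lemma near_s: "1 \<le> i \<Longrightarrow> i \<le> N \<Longrightarrow> near i (s i) (s (i - 1))"
  using s_square[of i] by (simp add: near_def s_C cong_def)

lemma near_add: "near i x y \<Longrightarrow> near i x' y' \<Longrightarrow> near i (x + x') (y + y')"
  by (simp add: near_def C_add distrib_left cong_add)

lemma near_mult:
  assumes "near i x y" "near i x' y'"
  shows "near i (x * x') (y * y')"
proof -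
  have "cong (x' * (s i * x)) (x' * (s i * y))"
    using assms by (simp add: near_def cong_mult_left)
  also have "x' * (s i * y) = y * (s i * x')"
    by (simp only: ac_simps)
  also have "cong (y * (s i * x')) (y * (s i * y'))"
    using assms by (simp add: near_def cong_mult_left)
  finally have "cong (s i * (x * x')) (s i * (y * y'))"
    by (simp only: ac_simps)
  then show ?thesis
    using assms by (simp add: near_def C_mult)
qed

lemma near_power: "near i x y \<Longrightarrow> near i (x ^ k) (y ^ k)"
  by (induction k) (auto simp: near_refl C_1 near_mult)

text \<open>One factor s_i lets the remaining i factors descend to s_(i-1); iterating this ends at
  s_0 = 0.\<close>

lemma s_nilpotent:
  assumes "i \<le> N" "k > i"
  shows "s i ^ k \<in> J"
proof -
  have "s i ^ Suc i \<in> J"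
    using assms(1)
  proof (induction i)
    case 0
    then show ?case by (simp add: s_0 J_0)
  next
    case (Suc i)
    have "cong (s (Suc i) * s (Suc i) ^ Suc i) (s (Suc i) * s i ^ Suc i)"
      using near_power[OF near_s[of "Suc i"], of "Suc i"] Suc.prems by (simp add: near_def)
    also have "cong (s (Suc i) * s i ^ Suc i) 0"
      unfolding cong_0_iff using Suc by (intro J_mult s_C) auto
    finally show ?case
      by (simp add: cong_0_iff)
  qed
  then have "s i ^ (k - Suc i) * s i ^ Suc i \<in> J"
    using assms(1) by (intro J_mult C_power s_C)
  moreover have "s i ^ (k - Suc i) * s i ^ Suc i = s i ^ k"
    using assms(2) by (simp only: power_add[symmetric]) simp
  ultimately show ?thesis
    by simp
qed

text \<open>After the top factor is peeled off, the induction yields a power in s_(i-1), which the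
  factor \<open>s i\<close> lifts back to a power in s_i through \<open>near\<close>. The bound on
  \<open>q\<close> keeps all indices nonnegative.\<close>

lemma cong_ladder_power:
  "q \<le> i \<Longrightarrow> i \<le> N \<Longrightarrow>
    cong (\<Prod>j<q. s (i - j) * (1 + s (i - j - 1))) ((s i * (1 + s i)) ^ q)"
proof (induction q arbitrary: i)
  case 0
  then show ?case by (simp add: cong_refl)
next
  case (Suc q)
  then have i: "1 \<le> i" "i \<le> N" "i - 1 \<le> N"
    by auto
  have "(\<Prod>j<Suc q. s (i - j) * (1 + s (i - j - 1))) =
      (s i * (1 + s (i - 1))) * (\<Prod>j<q. s (i - 1 - j) * (1 + s (i - 1 - j - 1)))"
    by (subst prod.lessThan_Suc_shift) simp
  also have "cong \<dots> ((s i * (1 + s (i - 1))) * (s (i - 1) * (1 + s (i - 1))) ^ q)"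
    using Suc i by (intro cong_mult_left Suc.IH C_mult C_add C_1 s_C) auto
  also have "(s i * (1 + s (i - 1))) * (s (i - 1) * (1 + s (i - 1))) ^ q =
      s i * ((1 + s (i - 1)) * (s (i - 1) * (1 + s (i - 1))) ^ q)"
    by (simp only: ac_simps)
  also have "cong \<dots> (s i * ((1 + s i) * (s i * (1 + s i)) ^ q))"
  proof -
    have one: "near i (1 + s i) (1 + s (i - 1))"
      by (intro near_add near_refl C_1 near_s i)
    have "near i ((1 + s i) * (s i * (1 + s i)) ^ q) ((1 + s (i - 1)) * (s (i - 1) * (1 + s (i - 1))) ^ q)"
      by (intro near_mult near_power one near_s i)
    then show ?thesis
      by (simp add: near_def cong_sym)
  qed
  also have "s i * ((1 + s i) * (s i * (1 + s i)) ^ q) = (s i * (1 + s i)) ^ Suc q"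
    by (simp only: power_Suc ac_simps)
  finally show ?case .
qed

lemma freshman: "(1 + x) ^ (2 ^ r) = 1 + (x :: 'r) ^ (2 ^ r)"
proof (induction r)
  case (Suc r)
  have "(1 + x) ^ (2 ^ Suc r) = (1 + x ^ 2 ^ r) * (1 + x ^ 2 ^ r)"
    by (simp only: power_Suc mult.commute[of 2] power_mult Suc power2_eq_square)
  also have "\<dots> = 1 + x ^ 2 ^ r * x ^ 2 ^ r"
    by (simp only: char2_simps)
  finally show ?case
    by (simp only: power_Suc mult.commute[of 2] power_mult power2_eq_square)
qed simp

text \<open>By \<open>freshman\<close> the term of index r equals x^(2^r - 1) + x^(2^(r+1) - 1), so
  consecutive terms cancel.\<close>

lemma geometric_telescope: "(\<Sum>r<R. (1 + x) * (x * (1 + x)) ^ (2 ^ r - 1)) = 1 + (x :: 'r) ^ (2 ^ R - 1)"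
proof (induction R)
  case 0
  then show ?case by (simp add: add_self[of 1, simplified])
next
  case (Suc R)
  obtain q where q: "(2::nat) ^ R = Suc q"
    using not0_implies_Suc[of "2 ^ R"] by auto
  have "(1 + x) * (x * (1 + x)) ^ (2 ^ R - 1) = x ^ q * (1 + x) ^ (2 ^ R)"
    by (simp add: q power_mult_distrib ac_simps)
  also have "\<dots> = x ^ q + x ^ (q + 2 ^ R)"
    by (simp add: freshman distrib_left power_add)
  finally have "(\<Sum>r<Suc R. (1 + x) * (x * (1 + x)) ^ (2 ^ r - 1)) =
      1 + x ^ q + (x ^ q + x ^ (q + 2 ^ R))"
    using Suc q by simp
  also have "\<dots> = 1 + x ^ (q + 2 ^ R)"
    by (simp only: char2_simps)
  also have "q + 2 ^ R = 2 ^ Suc R - 1"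
    using q by simp
  finally show ?case .
qed

lemma ladder_inverse_C: "m \<le> Suc N \<Longrightarrow> ladder_inverse s m \<in> C"
proof (induction m rule: less_induct)
  case (less m)
  show ?case
  proof (cases "m = 0")
    case True
    then show ?thesis by (simp add: ladder_inverse.simps C_1)
  next
    case False
    have "ladder_inverse s (m - 2 ^ r) \<in> C" for r
      using False less by (intro less) auto
    then show ?thesis
      using less.prems False
      by (subst ladder_inverse.simps) (auto intro!: C_sum C_mult C_prod s_C)
  qed
qed

text \<open>Put q = 2^r - 1 and i = m - 1. In the term of index r the lowest i - q factors of the
  product cancel against \<open>ladder_inverse s (i - q)\<close> by induction; the q + 1 others
  combine with the q factors s_(i-j) into a term of \<open>geometric_telescope\<close> for x =
  s_i.\<close>

lemma cong_ladder_inverse: "m \<le> Suc N \<Longrightarrow> cong ((\<Prod>i<m. 1 + s i) * ladder_inverse s m) 1"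
proof (induction m rule: less_induct)
  case (less m)
  show ?case
  proof (cases "m = 0")
    case True
    then show ?thesis by (simp add: ladder_inverse.simps cong_refl)
  next
    case False
    define i where "i = m - 1"
    have i: "m = Suc i" "i \<le> N"
      using False less.prems by (auto simp: i_def)
    define W where "W k = (\<Prod>i<k. 1 + s i)" for k
    have W_C: "W k \<in> C" if "k \<le> Suc N" for k
      unfolding W_def using that by (intro C_prod C_add C_1 s_C) auto
    obtain R where R: "{r. 2 ^ r \<le> m} = {..<R}" "m < 2 ^ R"
      using powers_le_eq_lessThan by blast
    have "W m * ladder_inverse s m =
        (\<Sum>r<R. W m * ((\<Prod>j<2 ^ r - 1. s (i - j)) * ladder_inverse s (m - 2 ^ r)))"
      using False by (subst ladder_inverse.simps) (simp add: R(1) sum_distrib_left i_def)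
    also have "cong \<dots> (\<Sum>r<R. (1 + s i) * (s i * (1 + s i)) ^ (2 ^ r - 1))"
    proof (rule cong_sum)
      fix r assume "r \<in> {..<R}"
      then have "2 ^ r \<le> m"
        using R(1) by blast
      moreover obtain q where q: "(2::nat) ^ r = Suc q"
        using not0_implies_Suc[of "2 ^ r"] by auto
      ultimately have "q \<le> i"
        using i by simp
      have m_q: "m - 2 ^ r = i - q"
        using q i by simp
      have split: "W (Suc i) = W (i - q) * (1 + s i) * (\<Prod>j<q. 1 + s (i - j - 1))" if "q \<le> i" for i q
        using that
      proof (induction q)
        case 0
        then show ?case by (simp add: W_def ac_simps)
      next
        case (Suc q)
        then have "i - q = Suc (i - Suc q)"
          by simp
        then have "W (i - q) = W (i - Suc q) * (1 + s (i - q - 1))"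
          by (simp add: W_def)
        then show ?case
          using Suc by (simp add: ac_simps)
      qed
      have "W m * ((\<Prod>j<2 ^ r - 1. s (i - j)) * ladder_inverse s (m - 2 ^ r)) =
          (W (i - q) * ladder_inverse s (i - q)) *
          ((1 + s i) * (\<Prod>j<q. s (i - j) * (1 + s (i - j - 1))))"
        unfolding i(1) split[OF \<open>q \<le> i\<close>] using q by (simp add: prod.distrib ac_simps)
      also have "cong \<dots> (1 * ((1 + s i) * (s i * (1 + s i)) ^ q))"
      proof (rule cong_mult)
        show "W (i - q) * ladder_inverse s (i - q) \<in> C"
          using i by (intro C_mult W_C ladder_inverse_C) auto
        show "(1 + s i) * (s i * (1 + s i)) ^ q \<in> C"
          using i by (intro C_mult C_power C_add C_1 s_C)
        show "cong (W (i - q) * ladder_inverse s (i - q)) 1"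
          unfolding W_def using i by (intro less) auto
        show "cong ((1 + s i) * (\<Prod>j<q. s (i - j) * (1 + s (i - j - 1)))) ((1 + s i) * (s i * (1 + s i)) ^ q)"
          using i \<open>q \<le> i\<close> by (intro cong_mult_left cong_ladder_power C_add C_1 s_C)
      qed
      finally show "cong (W m * ((\<Prod>j<2 ^ r - 1. s (i - j)) * ladder_inverse s (m - 2 ^ r)))
          ((1 + s i) * (s i * (1 + s i)) ^ (2 ^ r - 1))"
        using q by simp
    qed
    also have "\<dots> = 1 + s i ^ (2 ^ R - 1)"
      by (rule geometric_telescope)
    \<comment> \<open>From m < 2^R the exponent 2^R - 1 is at least m = i + 1, just enough for
      \<open>s_nilpotent\<close>.\<close>
    also have "cong \<dots> (1 + 0)"
      using R(2) i by (intro cong_add cong_refl) (auto simp: cong_0_iff intro: s_nilpotent)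
    finally show ?thesis
      by (simp add: W_def)
  qed
qed

text \<open>The product s_1 ... s_m is annihilated by s_m, because a repeated top factor descends to
  s_0 = 0. Hence s_m may be added to the next factor s_(m+1).\<close>

lemma cong_prod_increments:
  "m \<le> N \<Longrightarrow> cong (\<Prod>i=1..m. s i) (\<Prod>i=1..m. s i + s (i - 1))"
proof (induction m)
  case (Suc m)
  let ?p = "\<lambda>m. \<Prod>i=1..m. s i"
  have p_C: "?p k \<in> C" if "k \<le> N" for k
    using that by (intro C_prod s_C) auto
  have kill: "?p m * s m \<in> J" if "m \<le> N" for m
    using that
  proof (induction m)
    case (Suc m)
    have "?p (Suc m) * s (Suc m) = ?p m * (s (Suc m) * s (Suc m))"
      by (simp add: ac_simps)
    also have "cong \<dots> (?p m * (s (Suc m) * s m))"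
      using s_square[of "Suc m"] Suc.prems
      by (intro cong_mult_left[of "?p m"] p_C) (auto simp: cong_def)
    also have "\<dots> = s (Suc m) * (?p m * s m)"
      by (simp only: ac_simps)
    also have "cong \<dots> 0"
      unfolding cong_0_iff using Suc by (intro J_mult[of "s (Suc m)"] s_C) auto
    finally show ?case
      by (simp only: cong_0_iff)
  qed (simp add: s_0 J_0)
  have step: "?p (Suc m) = ?p m * s (Suc m)"
    by (subst prod.nat_ivl_Suc') (simp_all add: mult.commute)
  have "?p m * s (Suc m) + ?p m * (s (Suc m) + s m) = ?p m * s m"
    by (simp only: distrib_left add_self_left)
  then have "cong (?p (Suc m)) (?p m * (s (Suc m) + s m))"
    unfolding step cong_def using kill[of m] Suc.prems by (simp only: Suc_leD)
  also have "cong \<dots> ((\<Prod>i=1..m. s i + s (i - 1)) * (s (Suc m) + s m))"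
    using Suc by (intro cong_mult p_C C_add s_C cong_refl Suc.IH) auto
  finally show ?case
    by simp
qed (simp add: cong_refl)

end

text \<open>\<open>Hom i\<close> stands for the elements of degree i and \<open>Low m\<close> for
  those of degree less than m. If 2^r < m, the term of index r has degree at most (2^r - 1) + (m -
  2^r - 1) = m - 2, so degree m - 1 arises only from 2^r = m.\<close>

lemma ladder_inverse_leading:
  fixes s :: "nat \<Rightarrow> 'r::comm_ring_1" and Hom Low :: "nat \<Rightarrow> 'r set"
  assumes one: "1 \<in> Hom 0"
    and mult: "\<And>i j a b. a \<in> Hom i \<Longrightarrow> b \<in> Hom j \<Longrightarrow> a * b \<in> Hom (i + j)"
    and Low: "\<And>k m. k < m \<Longrightarrow> Hom k \<subseteq> Low m"
    and Low_mono: "\<And>m m'. m \<le> m' \<Longrightarrow> Low m \<subseteq> Low m'"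
    and Low_0: "\<And>m. 0 \<in> Low m"
    and Low_add: "\<And>m a b. a \<in> Low m \<Longrightarrow> b \<in> Low m \<Longrightarrow> a + b \<in> Low m"
    and Low_mult: "\<And>i m a b. a \<in> Hom i \<Longrightarrow> b \<in> Low m \<Longrightarrow> a * b \<in> Low (i + m)"
    and s: "\<And>i. i < N \<Longrightarrow> s i \<in> Hom 1"
    and N: "N = 2 ^ k"
  shows "\<exists>t\<in>Low (N - 1). ladder_inverse s N = (\<Prod>i=1..N - 1. s i) + t"
proof -
  have Low_sum: "sum f A \<in> Low m" if "\<And>r. r \<in> A \<Longrightarrow> f r \<in> Low m" for f :: "nat \<Rightarrow> 'r" and A m
    using that by (induction A rule: infinite_finite_induct) (auto simp: Low_0 Low_add)
  have run: "(\<Prod>j<q. s (m - 1 - j)) \<in> Hom q" if "1 \<le> m" "m \<le> N" for q m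
    using that
  proof (induction q)
    case (Suc q)
    then show ?case
      using mult[OF Suc.IH s[of "m - 1 - q"]] by simp
  qed (simp add: one)
  have low_term: "(\<Prod>j<2 ^ r - 1. s (m - 1 - j)) * ladder_inverse s (m - 2 ^ r) \<in> Low (m - 1)"
    if m: "1 \<le> m" "m \<le> N" and r: "2 ^ r < m"
      and IH: "ladder_inverse s (m - 2 ^ r) \<in> Low (m - 2 ^ r)" for m r
  proof -
    have "2 ^ r - 1 + (m - 2 ^ r) = m - 1"
      using r by (simp add: Nat.diff_add_assoc2[symmetric])
    then show ?thesis
      using Low_mult[OF run[OF m, of "2 ^ r - 1"] IH] by simp
  qed
  \<comment> \<open>The case m = 0 is excluded: there the inverse is 1, which is not of negative
    degree. This exception is the source of the leading term.\<close>
  have low: "ladder_inverse s m \<in> Low m" if "1 \<le> m" "m \<le> N" for m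
    using that
  proof (induction m rule: less_induct)
    case (less m)
    have "(\<Prod>j<2 ^ r - 1. s (m - 1 - j)) * ladder_inverse s (m - 2 ^ r) \<in> Low m" if r: "2 ^ r \<le> m" for r
    proof (cases "2 ^ r = m")
      case True
      then show ?thesis
        using run[of m "m - 1"] Low[of "m - 1" m] less.prems by (auto simp: ladder_inverse.simps[of s 0])
    next
      case False
      then have "ladder_inverse s (m - 2 ^ r) \<in> Low (m - 2 ^ r)"
        using r less.prems by (intro less.IH) auto
      then show ?thesis
        using low_term[OF less.prems, of r] False r Low_mono[of "m - 1" m] by auto
    qed
    then show ?case
      using less.prems by (subst ladder_inverse.simps) (auto intro!: Low_sum)
  qed
  have "1 \<le> N"
    by (simp add: N)
  let ?T = "\<lambda>r. (\<Prod>j<2 ^ r - 1. s (N - 1 - j)) * ladder_inverse s (N - 2 ^ r)"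
  \<comment> \<open>The exponent k uses up all of \<open>N\<close>: its term is the product of the N
    - 1 elements s_i times \<open>ladder_inverse s 0\<close> = 1.\<close>
  have "{r. 2 ^ r \<le> N} = insert k {r. 2 ^ r < N}"
    by (auto simp: N)
  moreover have "finite {r. 2 ^ r < N}"
    by (rule finite_subset[OF _ finite_powers_le[of N]]) auto
  ultimately have eq: "ladder_inverse s N = ?T k + (\<Sum>r | 2 ^ r < N. ?T r)"
    using \<open>1 \<le> N\<close> by (subst ladder_inverse.simps) (simp add: N)
  have "?T k = (\<Prod>i=1..N - 1. s i)"
  proof -
    have "?T k = (\<Prod>j<N - 1. s (Suc (N - 1 - Suc j)))"
      by (simp add: N ladder_inverse.simps[of s 0] Suc_diff_Suc cong: prod.cong_simp)
    also have "\<dots> = (\<Prod>i<N - 1. s (Suc i))"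
      by (rule prod.nat_diff_reindex)
    finally show ?thesis
      by (simp only: prod.atLeast1_atMost_eq One_nat_def)
  qed
  then have "ladder_inverse s N = (\<Prod>i=1..N - 1. s i) + (\<Sum>r | 2 ^ r < N. ?T r)"
    using eq by (simp only:)
  moreover have "(\<Sum>r | 2 ^ r < N. ?T r) \<in> Low (N - 1)"
  proof (rule Low_sum)
    fix r assume "r \<in> {r. 2 ^ r < N}"
    then have r: "2 ^ r < N"
      by simp
    then show "?T r \<in> Low (N - 1)"
      by (intro low_term low) (use \<open>1 \<le> N\<close> in auto)
  qed
  ultimately show ?thesis
    by (intro bexI)
qed

section \<open>Homogeneous cochains\<close>

definition cochain_add :: "'b cochain \<Rightarrow> 'b cochain \<Rightarrow> 'b cochain" where
  "cochain_add a b = (\<lambda>p f. a p f + b p f)"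

definition cochain_part :: "nat \<Rightarrow> 'b cochain \<Rightarrow> 'b cochain" where
  "cochain_part p a = (\<lambda>q. if q = p then a q else (\<lambda>f. 0))"

lemma cochain_add_assoc: "cochain_add (cochain_add a b) c = cochain_add a (cochain_add b c)"
  unfolding cochain_add_def by (simp only: add.assoc)

lemma cochain_add_self: "cochain_add a (cochain_add a b) = b"
proof -
  have "x + (x + y) = y" for x y :: bit
    by (cases x; cases y) simp_all
  then show ?thesis
    unfolding cochain_add_def by (simp only:)
qed

lemma coboundaries_add:
  assumes "a \<in> coboundaries X" "b \<in> coboundaries X"
  shows "cochain_add a b \<in> coboundaries X"
proof -
  obtain a' b' where a': "a' \<in> cochains X" "a = coboundary X a'" and b': "b' \<in> cochains X" "b = coboundary X b'"
    using assms by (auto simp: coboundaries_def)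
  have "cochain_add a' b' \<in> cochains X"
  proof -
    have "{p. cochain_add a' b' p \<noteq> (\<lambda>f. 0)} \<subseteq> {p. a' p \<noteq> (\<lambda>f. 0)} \<union> {p. b' p \<noteq> (\<lambda>f. 0)}"
      by (auto simp: cochain_add_def)
    then have "finite {p. cochain_add a' b' p \<noteq> (\<lambda>f. 0)}"
      by (rule finite_subset) (use a' b' in \<open>auto simp: cochains_def\<close>)
    moreover have "singular_simplex p X f" if "cochain_add a' b' p f \<noteq> 0" for p f
    proof -
      have "a' p f \<noteq> 0 \<or> b' p f \<noteq> 0"
        using that by (auto simp: cochain_add_def)
      then show ?thesis
        using a' b' by (auto simp: cochains_def)
    qed
    ultimately show ?thesis
      by (simp add: cochains_def)
  qed
  moreover have "coboundary X (cochain_add a' b') = cochain_add a b"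
  proof (intro ext)
    fix p f
    show "coboundary X (cochain_add a' b') p f = cochain_add a b p f"
      by (cases "p \<noteq> 0 \<and> singular_simplex p X f")
         (simp_all only: a'(2) b'(2) coboundary_def cochain_add_def sum.distrib if_True if_False add_0_left simp_thms)
  qed
  ultimately show ?thesis
    unfolding coboundaries_def by (metis imageI)
qed

lemma zero_in_coboundaries: "(\<lambda>p f. 0) \<in> coboundaries X"
proof -
  have "(\<lambda>p f. 0) \<in> cochains X"
    by (simp add: cochains_def)
  moreover have "coboundary X (\<lambda>p f. 0) = (\<lambda>p f. 0)"
    by (simp add: coboundary_def fun_eq_iff)
  ultimately show ?thesis
    unfolding coboundaries_def by (metis imageI)
qed

text \<open>The coboundary raises degrees by one, so the part of degree p comes from the part of
  degree p - 1 of a primitive; for p = 0 both are zero.\<close>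

lemma coboundaries_part:
  assumes "a \<in> coboundaries X"
  shows "cochain_part p a \<in> coboundaries X"
proof -
  obtain b where b: "b \<in> cochains X" "a = coboundary X b"
    using assms by (auto simp: coboundaries_def)
  define c where "c = (\<lambda>q. if Suc q = p then b q else (\<lambda>f. 0))"
  have "{q. c q \<noteq> (\<lambda>f. 0)} \<subseteq> {q. b q \<noteq> (\<lambda>f. 0)}"
    by (auto simp: c_def)
  then have "finite {q. c q \<noteq> (\<lambda>f. 0)}"
    by (rule finite_subset) (use b in \<open>auto simp: cochains_def\<close>)
  moreover have "singular_simplex q X f" if "c q f \<noteq> 0" for q f
    using b that by (auto simp: cochains_def c_def split: if_splits)
  ultimately have "c \<in> cochains X"
    by (simp add: cochains_def)
  moreover have "coboundary X c = cochain_part p a"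
    by (intro ext) (auto simp: b(2) coboundary_def cochain_part_def c_def)
  ultimately show ?thesis
    unfolding coboundaries_def by (metis imageI)
qed

lemma cohomology_class_eq: "cohomology_class X a = {cochain_add c a | c. c \<in> coboundaries X}"
  by (auto simp: cohomology_class_def a_r_coset_def' cocycle_ring_def cochain_add_def)

lemma cohomology_class_self: "a \<in> cohomology_class X a"
proof -
  have "a = cochain_add (\<lambda>p f. 0) a"
    by (simp only: cochain_add_def add_0_left)
  then show ?thesis
    unfolding cohomology_class_eq using zero_in_coboundaries by blast
qed

lemma cohomology_class_absorb:
  assumes c: "c \<in> coboundaries X"
  shows "cohomology_class X (cochain_add c a) = cohomology_class X a"
proof -
  have "cochain_add e (cochain_add c a) \<in> cohomology_class X a" if "e \<in> coboundaries X" for e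
    unfolding cohomology_class_eq cochain_add_assoc[symmetric] using coboundaries_add[OF that c] by blast
  moreover have "cochain_add e a \<in> cohomology_class X (cochain_add c a)" if "e \<in> coboundaries X" for e
  proof -
    have "cochain_add e a = cochain_add (cochain_add e c) (cochain_add c a)"
      by (simp only: cochain_add_assoc cochain_add_self)
    then show ?thesis
      unfolding cohomology_class_eq using coboundaries_add[OF that c] by blast
  qed
  ultimately show ?thesis
    unfolding cohomology_class_eq by blast
qed

lemma cohomology_class_representative:
  assumes "x \<in> carrier (cohomology_ring X)" "a \<in> x"
  shows "x = cohomology_class X a"
proof -
  obtain b where x: "x = cohomology_class X b"
    using assms(1) by (auto simp: cohomology_ring_def FactRing_def A_RCOSETS_def' cohomology_class_def)
  then obtain c where "c \<in> coboundaries X" "a = cochain_add c b"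
    using assms(2) by (auto simp: cohomology_class_eq)
  then show ?thesis
    using cohomology_class_absorb x by metis
qed

text \<open>Two representatives differ by a coboundary, whose parts are coboundaries again; so all
  members of the union in \<open>homogeneous_part\<close> coincide.\<close>

lemma homogeneous_part_representative:
  assumes x: "x \<in> carrier (cohomology_ring X)" and a: "a \<in> x"
  shows "homogeneous_part X p x = cohomology_class X (cochain_part p a)"
proof -
  have const: "cohomology_class X (cochain_part p b) = cohomology_class X (cochain_part p a)" if "b \<in> x" for b
  proof -
    have "b \<in> cohomology_class X a"
      using that cohomology_class_representative[OF x a] by simp
    then obtain c where c: "c \<in> coboundaries X" "b = cochain_add c a"
      by (auto simp: cohomology_class_eq)
    have "cochain_part p b = cochain_add (cochain_part p c) (cochain_part p a)"
      by (auto simp: c(2) cochain_part_def cochain_add_def fun_eq_iff)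
    then show ?thesis
      using cohomology_class_absorb coboundaries_part c(1) by metis
  qed
  have "(\<Union>b\<in>x. cohomology_class X (cochain_part p b)) = cohomology_class X (cochain_part p a)"
    using a const by blast
  then show ?thesis
    by (simp only: homogeneous_part_def cochain_part_def)
qed

lemma cohomology_ring_zero_mem: "(\<lambda>p f. 0) \<in> \<zero>\<^bsub>cohomology_ring X\<^esub>"
  by (simp add: cohomology_ring_def FactRing_def zero_in_coboundaries)

lemma cohomology_ring_one_mem:
  "(\<lambda>p f. if p = 0 \<and> singular_simplex 0 X f then 1 else 0) \<in> \<one>\<^bsub>cohomology_ring X\<^esub>"
proof -
  have "\<one>\<^bsub>cohomology_ring X\<^esub> =
      cohomology_class X (\<lambda>p f. if p = 0 \<and> singular_simplex 0 X f then 1 else 0)"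
    by (simp only: cohomology_ring_def FactRing_def cohomology_class_def cocycle_ring_def
        monoid.simps ring.simps)
  then show ?thesis
    by (simp only: cohomology_class_self)
qed

lemma cohomology_ring_add_mem:
  "a \<in> x \<Longrightarrow> b \<in> y \<Longrightarrow> cochain_add a b \<in> x \<oplus>\<^bsub>cohomology_ring X\<^esub> y"
  by (auto simp: cohomology_ring_def FactRing_def set_add_def' cocycle_ring_def cochain_add_def)

text \<open>The product of two cosets is by definition a union over all pairs of representatives, so
  any chosen pair gives a member. Degrees of products can thus be read off cochains.\<close>

lemma cohomology_ring_mult_mem:
  assumes "a \<in> x" "b \<in> y"
  shows "cup X a b \<in> x \<otimes>\<^bsub>cohomology_ring X\<^esub> y"
proof -
  have "cup X a b \<in> coboundaries X +>\<^bsub>cocycle_ring X\<^esub> (a \<otimes>\<^bsub>cocycle_ring X\<^esub> b)"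
    using cohomology_class_self[of "cup X a b" X] by (simp add: cohomology_class_def cocycle_ring_def)
  moreover have "x \<otimes>\<^bsub>cohomology_ring X\<^esub> y =
      (\<Union>a\<in>x. \<Union>b\<in>y. coboundaries X +>\<^bsub>cocycle_ring X\<^esub> (a \<otimes>\<^bsub>cocycle_ring X\<^esub> b))"
    by (simp only: cohomology_ring_def FactRing_def rcoset_mult_def monoid.simps)
  ultimately show ?thesis
    using assms by blast
qed

lemma cup_degree_less:
  assumes a: "\<And>p. p \<noteq> i \<Longrightarrow> a p = (\<lambda>f. 0)" and b: "\<And>p. j \<le> p \<Longrightarrow> b p = (\<lambda>f. 0)"
    and m: "i + j \<le> m"
  shows "cup X a b m = (\<lambda>f. 0)"
proof -
  have "a p (front_face p f) * b (m - p) (back_face p (m - p) f) = 0" for p f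
    using a[of p] b[of "m - p"] m by (cases "p = i") simp_all
  then show ?thesis
    by (simp only: cup_def sum.neutral_const if_cancel)
qed

lemma cup_degree:
  assumes a: "\<And>p. p \<noteq> i \<Longrightarrow> a p = (\<lambda>f. 0)" and b: "\<And>p. p \<noteq> j \<Longrightarrow> b p = (\<lambda>f. 0)"
    and m: "m \<noteq> i + j"
  shows "cup X a b m = (\<lambda>f. 0)"
proof -
  have "a p (front_face p f) * b (m - p) (back_face p (m - p) f) = 0" if "p \<le> m" for p f
    using a[of p] b[of "m - p"] m that by (cases "p = i") auto
  then have "(\<Sum>p\<le>m. a p (front_face p f) * b (m - p) (back_face p (m - p) f)) = 0" for f
    by (intro sum.neutral) blast
  then show ?thesis
    by (simp only: cup_def if_cancel)
qed

section \<open>The facet relations\<close>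

lemma facet_relations:
  fixes P :: "'a::euclidean_space set"
  assumes P: "simple_polytope n P" and h: "proper_coloring n P h" and V: "base_vertex n P h V H"
  defines "Q \<equiv> polynomial_ring (facets P)"
  defines "J \<equiv> Idl\<^bsub>Q\<^esub> (nonface_monomials P \<union> linear_forms n P h H)"
  defines "s \<equiv> \<lambda>i. \<Sum>j=1..i. poly_var (H j)"
  shows facets_char2_ideal: "char2_ideal (carrier Q) J"
    and facets_ladder: "ladder (carrier Q) J s n"
    and facets_total_class:
      "char2_ideal.cong J (\<Prod>F\<in>facets P. 1 + poly_var F) (\<Prod>i<n. 1 + s i)"
proof -
  interpret Q: cring Q
    unfolding Q_def by (rule cring_polynomial_ring)
  have gens: "nonface_monomials P \<union> linear_forms n P h H \<subseteq> carrier Q"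
    unfolding Q_def by (rule generators_in_carrier[OF V])
  interpret J: ideal J Q
    unfolding J_def using gens by (rule Q.genideal_ideal)
  have gens_J: "nonface_monomials P \<union> linear_forms n P h H \<subseteq> J"
    unfolding J_def using gens by (rule Q.genideal_self)
  show c2: "char2_ideal (carrier Q) J"
  proof
    show "0 \<in> J"
      using J.zero_closed by (simp add: Q_def)
    show "x + y \<in> J" if "x \<in> J" "y \<in> J" for x y
      using J.a_closed[OF that] by (simp add: Q_def)
    show "x * y \<in> J" if "x \<in> carrier Q" "y \<in> J" for x y
      using J.I_l_closed[OF that(2,1)] by (simp add: Q_def)
  qed (auto simp: Q_def polynomial_ring_closed intro: bit_poly_add_self)
  interpret char2_ideal "carrier Q" J
    by (rule c2)
  note H = base_vertex_bij[OF V]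
  have fin: "finite (facets P)"
    using P by (simp add: simple_polytope_def finite_facets)
  have var: "poly_var F \<in> carrier Q" if "F \<in> facets P" for F
    using that by (simp add: Q_def polynomial_ring_var)
  have Hf: "H i \<in> facets P" if "1 \<le> i" "i \<le> n" for i
    using H(2) that by auto
  have s_C: "s i \<in> carrier Q" if "i \<le> n" for i
    unfolding s_def using that by (intro C_sum var Hf) auto
  have same_colour: "poly_var F * poly_var G \<in> J"
    if "F \<in> facets P" "G \<in> facets P" "F \<noteq> G" "h F = h G" for F G
  proof -
    have "F \<inter> G = {}"
      using h that unfolding proper_coloring_def by blast
    then have "(\<Prod>K\<in>{F, G}. poly_var K) \<in> nonface_monomials P"
      unfolding nonface_monomials_def using that(1,2) by blast
    then show ?thesis
      using gens_J that(3) by auto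
  qed
  define C where "C i = {F \<in> facets P. h F = i}" for i
  have finC: "finite (C i)" for i
    using fin by (simp add: C_def)
  have HC: "H i \<in> C i" if "1 \<le> i" "i \<le> n" for i
    using H(3) Hf that by (simp add: C_def)
  have linear: "s i + (\<Sum>F\<in>C i - {H i}. poly_var F) \<in> J" if "1 \<le> i" "i \<le> n" for i
  proof -
    have "s i + (\<Sum>F\<in>C i - {H i}. poly_var F) \<in> linear_forms n P h H"
      unfolding linear_forms_def s_def C_def using that by auto
    then show ?thesis
      using gens_J by blast
  qed
  have s_Suc: "s i = s (i - 1) + poly_var (H i)" if "1 \<le> i" for i
    using that by (cases i) (simp_all add: s_def)
  show "ladder (carrier Q) J s n"
  proof
    show "s 0 = 0"
      by (simp add: s_def)
    show "s i \<in> carrier Q" if "i \<le> n" for i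
      using that by (rule s_C)
    fix i assume i: "1 \<le> i" "i \<le> n"
    let ?u = "poly_var (H i)"
    have "?u * (s i + (\<Sum>F\<in>C i - {H i}. poly_var F)) \<in> J"
      using i by (intro J_mult var Hf linear)
    moreover have "?u * (\<Sum>F\<in>C i - {H i}. poly_var F) \<in> J"
      unfolding sum_distrib_left
      using i by (intro J_sum same_colour Hf) (auto simp: C_def H(3))
    ultimately have "?u * (s i + (\<Sum>F\<in>C i - {H i}. poly_var F)) + ?u * (\<Sum>F\<in>C i - {H i}. poly_var F) \<in> J"
      by (rule J_add)
    then have "?u * s i \<in> J"
      by (simp only: distrib_left add.assoc add_self add_0_right)
    moreover have "s i * s i + s i * s (i - 1) = ?u * s i"
      by (subst (2) s_Suc[OF i(1)]) (simp only: char2_simps)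
    ultimately show "s i * s i + s i * s (i - 1) \<in> J"
      by simp
  qed
  have colour_class: "cong (\<Prod>F\<in>A. 1 + poly_var F) (1 + (\<Sum>F\<in>A. poly_var F))"
    if "finite A" "A \<subseteq> C i" for A i
    using that
  proof (induction A rule: finite_induct)
    case empty
    then show ?case by (simp add: cong_refl)
  next
    case (insert G A)
    have G: "poly_var G \<in> carrier Q" "1 + poly_var G \<in> carrier Q"
      using insert.prems by (auto simp: C_def intro!: var C_add C_1)
    have "(\<Prod>F\<in>insert G A. 1 + poly_var F) = (1 + poly_var G) * (\<Prod>F\<in>A. 1 + poly_var F)"
      using insert.hyps by simp
    also have "cong \<dots> ((1 + poly_var G) * (1 + (\<Sum>F\<in>A. poly_var F)))"
      using insert G by (intro cong_mult_left) auto
    also have "\<dots> = (1 + (\<Sum>F\<in>insert G A. poly_var F)) + (\<Sum>F\<in>A. poly_var G * poly_var F)"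
      using insert.hyps by (simp add: distrib_left distrib_right sum_distrib_left sum.distrib add_ac)
    also have "cong \<dots> ((1 + (\<Sum>F\<in>insert G A. poly_var F)) + 0)"
    proof (intro cong_add cong_refl)
      have "poly_var G * poly_var F \<in> J" if "F \<in> A" for F
        using that insert by (intro same_colour) (auto simp: C_def)
      then show "cong (\<Sum>F\<in>A. poly_var G * poly_var F) 0"
        by (simp add: cong_0_iff J_sum)
    qed
    finally show ?case
      by simp
  qed
  have "cong (\<Prod>F\<in>C i. 1 + poly_var F) (1 + s (i - 1))" if i: "1 \<le> i" "i \<le> n" for i
  proof -
    have "cong (\<Prod>F\<in>C i. 1 + poly_var F) (1 + (\<Sum>F\<in>C i. poly_var F))"
      by (rule colour_class[OF finC subset_refl])
    also have "(1 + (\<Sum>F\<in>C i. poly_var F)) + (1 + s (i - 1)) = s i + (\<Sum>F\<in>C i - {H i}. poly_var F)"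
      unfolding sum.remove[OF finC HC[OF i]] s_Suc[OF i(1)] by (simp only: char2_simps)
    then have "cong (1 + (\<Sum>F\<in>C i. poly_var F)) (1 + s (i - 1))"
      using linear[OF i] by (simp only: cong_def)
    finally show ?thesis .
  qed
  moreover have "(\<Prod>F\<in>facets P. 1 + poly_var F) = (\<Prod>i=1..n. \<Prod>F\<in>C i. 1 + poly_var F)"
    unfolding C_def using fin h by (intro prod.group[symmetric]) (auto simp: proper_coloring_def)
  \<comment> \<open>The shift by one matters: colour 1 contributes 1 + s_0 = 1, and s_n does not
    occur in the total class.\<close>
  moreover have "(\<Prod>i=1..n. 1 + s (i - 1)) = (\<Prod>i<n. 1 + s i)"
    by (simp add: prod.atLeast1_atMost_eq)
  ultimately show "cong (\<Prod>F\<in>facets P. 1 + poly_var F) (\<Prod>i<n. 1 + s i)"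
    by (auto intro!: cong_prod C_prod C_add C_1 var s_C simp: C_def
        simp flip: \<open>(\<Prod>i=1..n. 1 + s (i - 1)) = (\<Prod>i<n. 1 + s i)\<close>)
qed

text \<open>Transports the ring laws to the cohomology ring along the presentation. Preservation of
  zero is a separate premise because \<open>ring_hom\<close> does not include it; in the application
  it comes from the description of the kernel.\<close>

lemma surjective_image_cring:
  assumes "cring Q" and \<Phi>: "\<Phi> \<in> ring_hom Q R" and surj: "\<Phi> ` carrier Q = carrier R"
    and zero: "\<Phi> \<zero>\<^bsub>Q\<^esub> = \<zero>\<^bsub>R\<^esub>"
  shows "cring R"
proof -
  interpret Q: cring Q
    by fact
  note hom = ring_hom_memE[OF \<Phi>]
  have ex: "\<exists>a\<in>carrier Q. x = \<Phi> a" if "x \<in> carrier R" for x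
    using that surj by blast
  show ?thesis
  proof (rule cringI)
    show "abelian_group R"
    proof (rule abelian_groupI)
      fix x assume "x \<in> carrier R"
      then obtain a where a: "a \<in> carrier Q" "x = \<Phi> a"
        using ex by blast
      have "\<Phi> (\<ominus>\<^bsub>Q\<^esub> a) \<oplus>\<^bsub>R\<^esub> x = \<zero>\<^bsub>R\<^esub>"
        using a hom(3)[of "\<ominus>\<^bsub>Q\<^esub> a" a] zero by (simp add: Q.l_neg)
      then show "\<exists>y\<in>carrier R. y \<oplus>\<^bsub>R\<^esub> x = \<zero>\<^bsub>R\<^esub>"
        using a hom(1) by blast
      show "\<zero>\<^bsub>R\<^esub> \<oplus>\<^bsub>R\<^esub> x = x"
        using a hom(3)[of "\<zero>\<^bsub>Q\<^esub>" a] zero by simp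
    next
      show "\<zero>\<^bsub>R\<^esub> \<in> carrier R"
        using zero hom(1)[of "\<zero>\<^bsub>Q\<^esub>"] by simp
    qed (auto dest!: ex simp: hom(2-4)[symmetric] hom(1) Q.a_ac)
    show "comm_monoid R"
      by (rule comm_monoidI)
         (auto dest!: ex simp: hom(2-4)[symmetric] hom(1) Q.m_ac)
  qed (auto dest!: ex simp: hom(2-4)[symmetric] hom(1) Q.l_distr)
qed

theorem mainTheorem4:
  fixes P :: "'a::euclidean_space set"
    and h :: "'a set \<Rightarrow> nat"
    and V :: 'a
    and H :: "nat \<Rightarrow> 'a set"
    and n d :: nat
    and M :: "((nat \<Rightarrow> complex) \<times> 'a) set topology"
    and A :: "(((nat \<Rightarrow> complex) \<times> 'a) set, 'e::euclidean_space) chart set"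
    and v :: "'a set \<Rightarrow> ((nat \<Rightarrow> complex) \<times> 'a) set cochain set"
  assumes n: "\<exists>k::nat. n = 2 ^ k"
    and d: "d \<in> {1, 2}"
    and P: "simple_polytope n P"
    and h: "proper_coloring n P h"
    and V: "base_vertex n P h V H"
    and M: "M = toric_space d n P (char_vector h H)"
    and dim: "DIM('e) = d * n"
    and A: "smooth_atlas M A"
    and action: "locally_standard d n M A (toric_action d n)"
    and v: "\<And>F. F \<in> facets P \<Longrightarrow> v F \<in> cohomology_group d M"
    and DJ_ring: "presented_by_facets n P h H (cohomology_ring M) v"
    and DJ_SW: "manifold_SW_class M A =
      (\<Otimes>\<^bsub>cohomology_ring M\<^esub>F\<in>facets P. (\<one>\<^bsub>cohomology_ring M\<^esub> \<oplus>\<^bsub>cohomology_ring M\<^esub> v F))"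
  shows "homogeneous_part M (d * (n - 1)) (dual_SW_class M A) \<noteq> \<zero>\<^bsub>cohomology_ring M\<^esub>"
proof -
  define Q where "Q = polynomial_ring (facets P)"
  define R where "R = cohomology_ring M"
  define J where "J = Idl\<^bsub>Q\<^esub> (nonface_monomials P \<union> linear_forms n P h H)"
  define s where "s = (\<lambda>i. \<Sum>j=1..i. poly_var (H j))"
  obtain k where k: "n = 2 ^ k"
    using n by blast
  then have n1: "1 \<le> n"
    by simp
  have d1: "1 \<le> d"
    using d by auto

  interpret ladder "carrier Q" J s n
    unfolding Q_def J_def s_def by (rule facets_ladder[OF P h V])
  have fin: "finite (facets P)"
    using P by (simp add: simple_polytope_def finite_facets)
  have var: "poly_var F \<in> carrier Q" if "F \<in> facets P" for F
    using that by (simp add: Q_def polynomial_ring_var)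
  note H = base_vertex_bij[OF V]
  have Hf: "H i \<in> facets P" if "1 \<le> i" "i \<le> n" for i
    using H(2) that by auto
  have s_Suc: "s i = s (i - 1) + poly_var (H i)" if "1 \<le> i" for i
    using that by (cases i) (simp_all add: s_def)

  \<comment> \<open>The presentation as a surjection with kernel \<open>J\<close>\<close>
  obtain \<Phi> where \<Phi>: "\<Phi> \<in> ring_hom Q R" and \<Phi>_var: "\<And>F. F \<in> facets P \<Longrightarrow> \<Phi> (poly_var F) = v F"
    and surj: "\<Phi> ` carrier Q = carrier R" and ker: "a_kernel Q R \<Phi> = J"
    using DJ_ring unfolding presented_by_facets_def Q_def[symmetric] R_def[symmetric] J_def[symmetric]
    by blast
  have hom_closed: "\<Phi> p \<in> carrier R" if "p \<in> carrier Q" for p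
    using ring_hom_memE(1)[OF \<Phi>] that by blast
  have hom_mult: "\<Phi> (p * q) = \<Phi> p \<otimes>\<^bsub>R\<^esub> \<Phi> q" if "p \<in> carrier Q" "q \<in> carrier Q" for p q
    using ring_hom_memE(2)[OF \<Phi> that] by (simp add: Q_def)
  have hom_add: "\<Phi> (p + q) = \<Phi> p \<oplus>\<^bsub>R\<^esub> \<Phi> q" if "p \<in> carrier Q" "q \<in> carrier Q" for p q
    using ring_hom_memE(3)[OF \<Phi> that] by (simp add: Q_def)
  have hom_one: "\<Phi> 1 = \<one>\<^bsub>R\<^esub>"
    using ring_hom_memE(4)[OF \<Phi>] by (simp add: Q_def)
  have kernel: "p \<in> J \<longleftrightarrow> p \<in> carrier Q \<and> \<Phi> p = \<zero>\<^bsub>R\<^esub>" for p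
    unfolding ker[symmetric] a_kernel_def' by simp
  have hom_zero: "\<Phi> 0 = \<zero>\<^bsub>R\<^esub>"
    using J_0 kernel by blast
  interpret R: cring R
    by (rule surjective_image_cring[OF _ \<Phi> surj]) (simp_all add: Q_def cring_polynomial_ring flip: hom_zero)
  have cong_hom: "\<Phi> p = \<Phi> q" if "cong p q" "p \<in> carrier Q" "q \<in> carrier Q" for p q
  proof -
    have "p + q \<in> J"
      using that by (simp add: cong_def)
    then have J: "p + q \<in> carrier Q" "\<Phi> (p + q) = \<zero>\<^bsub>R\<^esub>"
      using kernel by auto
    have "\<Phi> (q + (p + q)) = \<Phi> q"
      unfolding hom_add[OF that(3) J(1)] J(2) using hom_closed[OF that(3)] by (rule R.r_zero)
    moreover have "q + (p + q) = p"
      by (simp only: char2_simps)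
    ultimately show ?thesis
      by simp
  qed

  \<comment> \<open>The dual class as the image of a polynomial\<close>
  let ?E = "ladder_inverse s n"
  let ?W = "\<Prod>F\<in>facets P. 1 + poly_var F"
  have E_C: "?E \<in> carrier Q"
    by (rule ladder_inverse_C) simp
  have W_C: "?W \<in> carrier Q"
    by (intro C_prod C_add C_1 var)
  have total_class: "cong ?W (\<Prod>i<n. 1 + s i)"
    unfolding J_def Q_def s_def by (rule facets_total_class[OF P h V])
  have "cong (?W * ?E) ((\<Prod>i<n. 1 + s i) * ?E)"
    using W_C E_C total_class by (intro cong_mult cong_refl)
  also have "cong \<dots> 1"
    by (rule cong_ladder_inverse) simp
  finally have "\<Phi> (?W * ?E) = \<Phi> 1"
    by (rule cong_hom) (intro C_mult W_C E_C C_1)+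
  then have inverse: "\<Phi> ?W \<otimes>\<^bsub>R\<^esub> \<Phi> ?E = \<one>\<^bsub>R\<^esub>"
    by (simp add: hom_mult W_C E_C hom_one)
  have "\<Phi> (\<Prod>F\<in>S. 1 + poly_var F) = (\<Otimes>\<^bsub>R\<^esub>F\<in>S. \<one>\<^bsub>R\<^esub> \<oplus>\<^bsub>R\<^esub> v F)" if "S \<subseteq> facets P" for S
    using finite_subset[OF that fin] that
  proof (induction S rule: finite_induct)
    case empty
    then show ?case by (simp add: hom_one)
  next
    case (insert F S)
    have vR: "v G \<in> carrier R" if "G \<in> facets P" for G
      using hom_closed[OF var[OF that]] \<Phi>_var[OF that] by simp
    have "(\<Prod>F\<in>S. 1 + poly_var F) \<in> carrier Q" "1 + poly_var F \<in> carrier Q" "poly_var F \<in> carrier Q"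
      using insert.prems by (auto intro!: C_prod C_add C_1 var)
    then have "\<Phi> ((1 + poly_var F) * (\<Prod>F\<in>S. 1 + poly_var F)) =
        (\<one>\<^bsub>R\<^esub> \<oplus>\<^bsub>R\<^esub> v F) \<otimes>\<^bsub>R\<^esub> (\<Otimes>\<^bsub>R\<^esub>F\<in>S. \<one>\<^bsub>R\<^esub> \<oplus>\<^bsub>R\<^esub> v F)"
      using insert by (simp add: hom_mult hom_add C_1 hom_one \<Phi>_var)
    then show ?case
      using insert vR by (subst R.finprod_insert) (auto intro!: R.add.m_closed)
  qed
  then have "manifold_SW_class M A = \<Phi> ?W"
    using DJ_SW by (simp add: R_def)
  then have dual: "dual_SW_class M A = \<Phi> ?E"
    unfolding dual_SW_class_def R_def[symmetric]
    using R.comm_inv_char[OF hom_closed[OF W_C] hom_closed[OF E_C] inverse] by simp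

  \<comment> \<open>The degree of a polynomial is that of its image in cohomology, witnessed by one
    representative cochain. A polynomial in \<open>J\<close> therefore belongs to every
    \<open>Hom i\<close>.\<close>
  define Hom where "Hom i = {p \<in> carrier Q. \<exists>a\<in>\<Phi> p. \<forall>q. q \<noteq> d * i \<longrightarrow> a q = (\<lambda>f. 0)}" for i
  define Low where "Low m = {p \<in> carrier Q. \<exists>a\<in>\<Phi> p. \<forall>q\<ge>d * m. a q = (\<lambda>f. 0)}" for m
  have Hom_add: "p + q \<in> Hom i" if asm: "p \<in> Hom i" "q \<in> Hom i" for p q i
  proof -
    obtain a b where "a \<in> \<Phi> p" "b \<in> \<Phi> q"
      and zero: "\<And>j. j \<noteq> d * i \<Longrightarrow> a j = (\<lambda>f. 0)" "\<And>j. j \<noteq> d * i \<Longrightarrow> b j = (\<lambda>f. 0)"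
      using asm unfolding Hom_def by blast
    then have "cochain_add a b \<in> \<Phi> (p + q)"
      using asm cohomology_ring_add_mem[of a _ b] by (auto simp: Hom_def hom_add R_def)
    moreover have "cochain_add a b j = (\<lambda>f. 0)" if "j \<noteq> d * i" for j
      by (simp add: cochain_add_def zero that)
    ultimately show ?thesis
      using asm by (auto simp: Hom_def intro: C_add)
  qed
  have s_Hom: "s i \<in> Hom 1" if "i \<le> n" for i
    using that
  proof (induction i)
    case 0
    show ?case
      using cohomology_ring_zero_mem[of M] by (auto simp: Hom_def s_0 C_0 hom_zero R_def)
  next
    case (Suc i)
    have "poly_var (H (Suc i)) \<in> Hom 1"
    proof -
      have F: "H (Suc i) \<in> facets P"
        using Suc.prems by (intro Hf) auto
      then obtain a where "v (H (Suc i)) = cohomology_class M a" "\<forall>q. q \<noteq> d \<longrightarrow> a q = (\<lambda>f. 0)"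
        using v[OF F] by (auto simp: cohomology_group_def)
      then show ?thesis
        using cohomology_class_self[of a M] \<Phi>_var[OF F] var[OF F] by (auto simp: Hom_def)
    qed
    then show ?case
      using Suc s_Suc[of "Suc i"] by (auto intro: Hom_add)
  qed
  have Hom_one: "1 \<in> Hom 0"
    unfolding Hom_def
  proof (intro CollectI conjI C_1 bexI)
    show "(\<lambda>p f. if p = 0 \<and> singular_simplex 0 M f then 1 else 0) \<in> \<Phi> 1"
      unfolding hom_one R_def by (rule cohomology_ring_one_mem)
  qed (auto simp: fun_eq_iff)
  have Hom_mult: "p * q \<in> Hom (i + j)" if asm: "p \<in> Hom i" "q \<in> Hom j" for p q i j
  proof -
    obtain a b where ab: "a \<in> \<Phi> p" "b \<in> \<Phi> q"
      and zero: "\<And>m. m \<noteq> d * i \<Longrightarrow> a m = (\<lambda>f. 0)" "\<And>m. m \<noteq> d * j \<Longrightarrow> b m = (\<lambda>f. 0)"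
      using asm unfolding Hom_def by blast
    have pq: "p \<in> carrier Q" "q \<in> carrier Q"
      using asm by (auto simp: Hom_def)
    have "cup M a b \<in> \<Phi> (p * q)"
      unfolding hom_mult[OF pq] R_def using ab by (rule cohomology_ring_mult_mem)
    moreover have "cup M a b m = (\<lambda>f. 0)" if "m \<noteq> d * (i + j)" for m
      using that by (intro cup_degree[OF zero]) (auto simp: distrib_left)
    ultimately show ?thesis
      using C_mult[OF pq] unfolding Hom_def by blast
  qed
  have Hom_Low: "Hom i \<subseteq> Low m" if "i < m" for i m
  proof -
    \<comment> \<open>Positivity of \<open>d\<close> keeps the rescaled degrees strictly
      ordered.\<close>
    have "d * i < d * m"
      using that d1 by simp
    then have "q \<noteq> d * i" if "q \<ge> d * m" for q
      using that by linarith
    then show ?thesis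
      unfolding Hom_def Low_def by blast
  qed
  have Low_mono: "Low m \<subseteq> Low m'" if "m \<le> m'" for m m'
  proof -
    have "d * m \<le> d * m'"
      using that by simp
    then show ?thesis
      unfolding Low_def using le_trans by blast
  qed
  have Low_0: "0 \<in> Low m" for m
    using cohomology_ring_zero_mem[of M] by (auto simp: Low_def C_0 hom_zero R_def)
  have Low_add: "p + q \<in> Low m" if asm: "p \<in> Low m" "q \<in> Low m" for p q m
  proof -
    obtain a b where ab: "a \<in> \<Phi> p" "b \<in> \<Phi> q"
      and zero: "\<And>j. j \<ge> d * m \<Longrightarrow> a j = (\<lambda>f. 0)" "\<And>j. j \<ge> d * m \<Longrightarrow> b j = (\<lambda>f. 0)"
      using asm unfolding Low_def by blast
    have pq: "p \<in> carrier Q" "q \<in> carrier Q"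
      using asm by (auto simp: Low_def)
    have "cochain_add a b \<in> \<Phi> (p + q)"
      unfolding hom_add[OF pq] R_def using ab by (rule cohomology_ring_add_mem)
    moreover have "cochain_add a b j = (\<lambda>f. 0)" if "j \<ge> d * m" for j
      by (simp add: cochain_add_def zero that)
    ultimately show ?thesis
      using C_add[OF pq] unfolding Low_def by blast
  qed
  have Low_mult: "p * q \<in> Low (i + m)" if asm: "p \<in> Hom i" "q \<in> Low m" for p q i m
  proof -
    obtain a b where ab: "a \<in> \<Phi> p" "b \<in> \<Phi> q"
      and zero: "\<And>j. j \<noteq> d * i \<Longrightarrow> a j = (\<lambda>f. 0)" "\<And>j. d * m \<le> j \<Longrightarrow> b j = (\<lambda>f. 0)"
      using asm unfolding Hom_def Low_def by blast
    have pq: "p \<in> carrier Q" "q \<in> carrier Q"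
      using asm by (auto simp: Hom_def Low_def)
    have "cup M a b \<in> \<Phi> (p * q)"
      unfolding hom_mult[OF pq] R_def using ab by (rule cohomology_ring_mult_mem)
    moreover have "cup M a b j = (\<lambda>f. 0)" if "j \<ge> d * (i + m)" for j
      using that by (intro cup_degree_less[OF zero]) (auto simp: distrib_left)
    ultimately show ?thesis
      using C_mult[OF pq] unfolding Low_def by blast
  qed
  have s_Hom': "s i \<in> Hom 1" if "i < n" for i
    using that by (intro s_Hom less_imp_le)
  have "\<exists>t\<in>Low (n - 1). ?E = (\<Prod>i=1..n - 1. s i) + t"
    by (rule ladder_inverse_leading[of Hom Low n s k])
       (rule Hom_one Hom_mult Hom_Low Low_mono Low_0 Low_add Low_mult s_Hom' k; assumption)+
  then obtain t where t: "t \<in> Low (n - 1)" "?E = (\<Prod>i=1..n - 1. s i) + t"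
    by blast
  let ?p = "\<Prod>i=1..n - 1. s i"
  have "(\<Prod>i=1..m. s i) \<in> Hom m" if "m \<le> n" for m
    using that
  proof (induction m)
    case (Suc m)
    then show ?case
      using Hom_mult[OF Suc.IH s_Hom[of "Suc m"]] by (simp add: mult.commute)
  qed (simp add: Hom_one)
  then have "?p \<in> Hom (n - 1)"
    by simp
  then obtain a where a: "a \<in> \<Phi> ?p" "\<And>q. q \<noteq> d * (n - 1) \<Longrightarrow> a q = (\<lambda>f. 0)" and p_C: "?p \<in> carrier Q"
    unfolding Hom_def by blast
  obtain b where b: "b \<in> \<Phi> t" "\<And>q. d * (n - 1) \<le> q \<Longrightarrow> b q = (\<lambda>f. 0)" and t_C: "t \<in> carrier Q"
    using t(1) unfolding Low_def by blast
  have "cochain_add a b \<in> \<Phi> ?E"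
    unfolding t(2) hom_add[OF p_C t_C] R_def using a(1) b(1) by (rule cohomology_ring_add_mem)
  then have "homogeneous_part M (d * (n - 1)) (\<Phi> ?E) =
      cohomology_class M (cochain_part (d * (n - 1)) (cochain_add a b))"
    using hom_closed[OF E_C] unfolding R_def by (intro homogeneous_part_representative)
  \<comment> \<open>In degree d(n - 1) the lower part \<open>b\<close> vanishes and \<open>a\<close>
    is concentrated there, so the part is represented by \<open>a\<close> itself.\<close>
  also have "cochain_part (d * (n - 1)) (cochain_add a b) = a"
    using a(2) b(2)[OF order_refl] by (auto simp: cochain_part_def cochain_add_def fun_eq_iff)
  also have "cohomology_class M a = \<Phi> ?p"
    using cohomology_class_representative[of "\<Phi> ?p" M a] hom_closed[OF p_C] a(1) by (simp add: R_def)
  finally have part: "homogeneous_part M (d * (n - 1)) (dual_SW_class M A) = \<Phi> ?p"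
    unfolding dual .
  \<comment> \<open>Multiplying by s_n raises the product to s_1 ... s_n, which is congruent to the
    monomial u_1 ... u_n of the base vertex.\<close>
  have "?p \<notin> J"
  proof
    assume "?p \<in> J"
    then have "s n * ?p \<in> J"
      by (intro J_mult s_C) simp
    moreover have "(\<Prod>i=1..n. s i) = s n * ?p"
      using n1 by (cases n) (simp_all add: mult.commute)
    ultimately have "cong (\<Prod>i=1..n. s i) 0"
      by (simp add: cong_0_iff)
    then have "cong (\<Prod>i=1..n. s i + s (i - 1)) 0"
      using cong_prod_increments[of n] cong_sym cong_trans by blast
    moreover have "(\<Prod>i=1..n. s i + s (i - 1)) = (\<Prod>i=1..n. poly_var (H i))"
    proof (rule prod.cong)
      fix i assume "i \<in> {1..n}"
      then have "s i + s (i - 1) = s (i - 1) + poly_var (H i) + s (i - 1)"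
        using s_Suc[of i] by simp
      then show "s i + s (i - 1) = poly_var (H i)"
        by (simp only: char2_simps)
    qed simp
    ultimately have "(\<Prod>i=1..n. poly_var (H i)) \<in> J"
      by (simp add: cong_0_iff)
    then show False
      using vertex_monomial_not_in_ideal[OF P n1 h V] by (simp add: J_def Q_def)
  qed
  then show ?thesis
    unfolding part using kernel p_C by (simp add: R_def)
qed

end
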